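(* For all $q\in(0,1)$ and $x\in(0,1)$, $$\log(x;q)_\infty=\frac{\mathrm{Li}_2(x)}{\log q}+\log\sqrt{1-x}-\frac{\log q}{24}-\int_0^\infty B\Bigl(-\frac{\log q}{2\pi}\,t\Bigr)\,x^{t}\,\frac{dt}{t}+M\Bigl(-\frac{\log q}{2\pi},\,\log_q x\Bigr),$$ where $B(t)=\frac{1}{e^{2\pi t}-1}-\frac{1}{2\pi t}+\frac12$, $\log_q x=\log x/\log q$, and for $\alpha>0$, $\nu\in\mathbb{R}$, $$M(\alpha,\nu)=-\sum_{n=1}^\infty\frac{\cos 2n\pi\nu}{n\,(e^{2n\pi/\alpha}-1)}-\frac{2}{\pi}\,\mathrm{PV}\!\int_0^\infty\sum_{n=1}^\infty\frac{\sin 2n\nu\pi t}{n\,(e^{2n\pi t/\alpha}-1)}\,\frac{dt}{1-t^2}.$$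
   Context: For $|q|<1$, $(x;q)_\infty=\prod_{n\ge0}(1-xq^n)$. $\mathrm{Li}_2$ is the dilogarithm, $\mathrm{Li}_2(x)=-\int_0^x\log(1-t)\,\frac{dt}{t}=\sum_{n\ge1}\frac{x^n}{n^2}$. $\mathrm{PV}\int$ denotes the Cauchy principal value (singularity at $t=1$). All logarithms are real. *)

theory Defs
  imports "HOL-Analysis.Analysis"
begin

definition qpoch_inf :: "real \<Rightarrow> real \<Rightarrow> real" where
  "qpoch_inf x q = (\<Prod>n. 1 - x * q ^ n)"

definition dilog :: "real \<Rightarrow> real" where
  "dilog x = (\<Sum>n. x ^ Suc n / (real (Suc n))\<^sup>2)"

(* Symmetric truncation around the single singularity c. Integrability of every truncation is
   required because a non-integrable function has Lebesgue integral 0 by convention. *)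
definition has_pv_integral :: "(real \<Rightarrow> real) \<Rightarrow> real \<Rightarrow> real \<Rightarrow> real set \<Rightarrow> bool" where
  "has_pv_integral f I c A \<longleftrightarrow>
     (\<forall>\<epsilon>>0. set_integrable lborel {t \<in> A. \<bar>t - c\<bar> > \<epsilon>} f) \<and>
     ((\<lambda>\<epsilon>. LINT t:{t \<in> A. \<bar>t - c\<bar> > \<epsilon>}|lborel. f t) \<longlongrightarrow> I) (at_right 0)"

definition pv_integral :: "(real \<Rightarrow> real) \<Rightarrow> real \<Rightarrow> real set \<Rightarrow> real" where
  "pv_integral f c A = (THE I. has_pv_integral f I c A)"

definition B_fun :: "real \<Rightarrow> real" where
  "B_fun t = 1 / (exp (2 * pi * t) - 1) - 1 / (2 * pi * t) + 1 / 2"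

definition M_integrand :: "real \<Rightarrow> real \<Rightarrow> real \<Rightarrow> real" where
  "M_integrand \<alpha> \<nu> t =
     (\<Sum>n. sin (2 * real (Suc n) * \<nu> * pi * t) /
           (real (Suc n) * (exp (2 * real (Suc n) * pi * t / \<alpha>) - 1))) / (1 - t\<^sup>2)"

definition M_fun :: "real \<Rightarrow> real \<Rightarrow> real" where
  "M_fun \<alpha> \<nu> =
     - (\<Sum>n. cos (2 * real (Suc n) * pi * \<nu>) /
             (real (Suc n) * (exp (2 * real (Suc n) * pi / \<alpha>) - 1)))
     - 2 / pi * pv_integral (M_integrand \<alpha> \<nu>) 1 {0<..}"

end

theory Submission
  imports Defs "HOL-Probability.Sinc_Integral" "HOL-Real_Asymp.Real_Asymp"
begin

text \<open>
  Write \<open>q = exp (- 2 pi \<alpha>)\<close>, \<open>x = q powr \<nu>\<close>, \<open>b = - ln x = 2 pi \<alpha> \<nu>\<close> and \<open>\<phi> s = 1 / (exp (2 pi s) - 1)\<close>.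
  Expanding the logarithms gives \<open>ln (x; q) = - (\<Sum>m\<ge>1. x^m / (m (1 - q^m)))\<close>, and since
  \<open>1 / (1 - q^m) = 1 / (2 pi \<alpha> m) + 1 / 2 + B (\<alpha> m)\<close>, everything reduces to comparing
  \<open>\<Sum>m\<ge>1. B (\<alpha> m) x^m / m\<close> with \<open>\<integral> B (\<alpha> t) x^t / t dt\<close>. By the partial fractions
  \<open>B s = (1 / pi) (\<Sum>n\<ge>1. s / (s^2 + n^2))\<close> both split into terms indexed by \<open>n\<close>, namely
  \<open>\<Sum>k\<ge>1. exp (- b k) / (a^2 + k^2)\<close> and \<open>\<integral> exp (- b u) / (a^2 + u^2) du\<close> with \<open>a = n / \<alpha>\<close>.

  The \<open>n\<close>-th term \<open>sin (a b t) \<phi> (a t) / n\<close> of the integrand of \<open>M\<close> is treated by dividing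
  \<open>t \<phi> (a t)\<close> by \<open>1 - t^2\<close>: the remainder is \<open>\<phi> a\<close>, and the same partial fractions expand the quotient as
  \<open>1 / (2 (1 + t)) - (1 / pi) (\<Sum>k\<ge>1. \<kappa> k)\<close> with \<open>\<kappa> u = a u^2 / ((a^2 t^2 + u^2) (a^2 + u^2))\<close>,
  while \<open>1 / (2 (1 + t)) = (1 / pi) \<integral> \<kappa> u du\<close>. Integrating against \<open>sin (a b t) / t\<close> turns \<open>\<kappa> u\<close> into
  \<open>(pi a / 2) (1 - exp (- b u)) / (a^2 + u^2)\<close>, so the quotient yields exactly the difference of the
  two terms above, and the remainder yields \<open>(pi / 2) (1 - cos (a b)) \<phi> a\<close>, whose cosine part cancels the
  cosine series in \<open>M\<close>. The leftover \<open>- pi \<alpha> / 12\<close> is \<open>- (\<alpha> / (2 pi)) \<zeta> 2\<close>.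
\<close>

section \<open>Integration on the half-line\<close>

text \<open>Restricting the measure, instead of multiplying by an indicator, lets Fubini and
  dominated convergence be applied directly on the half-line; the lemmas below translate to set
  integrals.\<close>

abbreviation pos_lborel :: "real measure" where
  "pos_lborel \<equiv> restrict_space lborel {0<..}"

lemma sigma_finite_pos_lborel: "sigma_finite_measure pos_lborel"
  by (rule sigma_finite_measure_restrict_space) (auto intro: sigma_finite_lborel)

lemma integrable_pos_lborel_iff: "integrable pos_lborel f \<longleftrightarrow> set_integrable lborel {0<..} f"
  for f :: "real \<Rightarrow> real"
  by (simp add: integrable_restrict_space set_integrable_def)

lemma integral_pos_lborel: "integral\<^sup>L pos_lborel f = (LINT t:{0<..}|lborel. f t)"
  for f :: "real \<Rightarrow> real"
  by (simp add: integral_restrict_space set_lebesgue_integral_def)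

lemma borel_measurable_pos_lborel: "f \<in> borel_measurable borel \<Longrightarrow> f \<in> borel_measurable pos_lborel"
  by (rule measurable_restrict_space1) simp

lemma AE_pos_lborel_neq: "AE t in pos_lborel. t \<noteq> c"
  using AE_lborel_singleton[of c] by (subst AE_restrict_space_iff) (auto elim: eventually_mono)

section \<open>Termwise integration and exchange of double series\<close>

text \<open>Dominated convergence for the partial sums: those of \<open>f\<close> are bounded by
  those of \<open>g\<close>, hence by \<open>G\<close>, so only the sum of the majorants has to be
  integrable.\<close>

lemma sums_integral_dominated:
  fixes f g :: "nat \<Rightarrow> 'a \<Rightarrow> real"
  assumes meas: "\<And>n. f n \<in> borel_measurable M" "F \<in> borel_measurable M"
    and le: "\<And>n x. x \<in> space M \<Longrightarrow> \<bar>f n x\<bar> \<le> g n x"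
    and sums: "AE x in M. (\<lambda>n. f n x) sums F x" "AE x in M. (\<lambda>n. g n x) sums G x"
    and G: "integrable M G"
  shows "integrable M (f n)" and "(\<lambda>n. integral\<^sup>L M (f n)) sums integral\<^sup>L M F"
proof -
  have nonneg: "0 \<le> g n x" if "x \<in> space M" for n x
    using le[OF that, of n] by linarith
  have sum_le: "AE x in M. (\<Sum>i<n. g i x) \<le> G x" for n
    using sums(2) AE_space
  proof eventually_elim
    case (elim x)
    then show ?case
      using sum_le_suminf[of "\<lambda>n. g n x" "{..<n}"] nonneg by (auto simp: sums_iff)
  qed
  have bd: "AE x in M. norm (\<Sum>i<n. f i x) \<le> G x" for n
    using sum_le[of n] AE_space
  proof eventually_elim
    case (elim x)
    have "norm (\<Sum>i<n. f i x) \<le> (\<Sum>i<n. g i x)"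
      by (rule sum_norm_le) (use le elim in auto)
    with elim show ?case by linarith
  qed
  have int: "integrable M (f n)" for n
  proof (rule Bochner_Integration.integrable_bound[OF G meas(1)])
    show "AE x in M. norm (f n x) \<le> norm (G x)"
      using sum_le[of "Suc n"] AE_space
    proof eventually_elim
      case (elim x)
      have "g n x \<le> (\<Sum>i<Suc n. g i x)" using nonneg elim by (simp add: sum_nonneg)
      then show ?case using elim le[of x n] by auto
    qed
  qed
  show "integrable M (f n)" by (rule int)
  have "(\<lambda>n. integral\<^sup>L M (\<lambda>x. \<Sum>i<n. f i x)) \<longlonglongrightarrow> integral\<^sup>L M F"
    by (rule integral_dominated_convergence[OF _ _ G _ bd])
       (use meas sums in \<open>auto simp: sums_def\<close>)
  then show "(\<lambda>n. integral\<^sup>L M (f n)) sums integral\<^sup>L M F"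
    by (simp add: sums_def int)
qed

text \<open>Tonelli for double series: on counting measure the previous lemma applies with
  \<open>f\<close> as its own majorant, because all terms are nonnegative.\<close>

lemma sums_swap_nonneg:
  fixes f :: "nat \<Rightarrow> nat \<Rightarrow> real"
  assumes nonneg: "\<And>n m. 0 \<le> f n m"
    and row: "\<And>m. (\<lambda>n. f n m) sums F m" and F: "F sums s" and col: "\<And>n. f n sums G n"
  shows "G sums s"
proof -
  have F0: "0 \<le> F m" for m
    using sums_le[OF _ sums_zero row[of m]] nonneg by simp
  have I: "integrable (count_space UNIV) F"
    using F F0 by (simp add: integrable_count_space_nat_iff sums_iff)
  have "(\<lambda>n. integral\<^sup>L (count_space UNIV) (f n)) sums integral\<^sup>L (count_space UNIV) F"
    using nonneg row by (intro sums_integral_dominated(2)[OF _ _ _ _ _ I, where g = f]) auto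
  moreover have "integral\<^sup>L (count_space UNIV) F = s"
    using F I by (simp add: integral_count_space_nat sums_iff)
  moreover have "integral\<^sup>L (count_space UNIV) (f n) = G n" for n
  proof -
    have "integrable (count_space UNIV) (f n)"
      using nonneg col by (auto simp: integrable_count_space_nat_iff sums_iff)
    then show ?thesis using col by (simp add: integral_count_space_nat sums_iff)
  qed
  ultimately show ?thesis by simp
qed

section \<open>Partial fractions of the hyperbolic cotangent\<close>

text \<open>Differentiating the reflection formula of the Gamma function on the imaginary axis
  expresses the cotangent through \<open>Digamma (1 - z) - Digamma z\<close>; the series of
  \<open>Digamma\<close> then gives the expansion.\<close>

lemma coth_partial_fractions:
  fixes s :: real
  assumes "s \<noteq> 0"
  shows "(\<lambda>n. 2 * s / (s\<^sup>2 + (real (Suc n))\<^sup>2)) sums (pi * cosh (pi * s) / sinh (pi * s) - 1 / s)"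
proof -
  define z where "z = \<i> * complex_of_real s"
  have notint: "z + of_int k \<notin> \<int>\<^sub>\<le>\<^sub>0" "- z + of_int k \<notin> \<int>\<^sub>\<le>\<^sub>0" for k
    using assms by (auto simp: z_def complex_eq_iff elim!: nonpos_Ints_cases)
  have nz: "z \<notin> \<int>\<^sub>\<le>\<^sub>0" "1 - z \<notin> \<int>\<^sub>\<le>\<^sub>0" "1 + z \<notin> \<int>\<^sub>\<le>\<^sub>0"
    using notint(1)[of 0] notint(2)[of 1] notint(1)[of 1] by (simp_all add: algebra_simps)
  have z0: "z \<noteq> 0" using assms by (simp add: z_def)
  \<comment> \<open>Both sides of the reflection formula are differentiated at \<open>z\<close>;
    uniqueness of the derivative equates the results.\<close>
  have "((\<lambda>w. rGamma w * rGamma (1 - w)) has_field_derivative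
      (- rGamma z * Digamma z) * rGamma (1 - z) + (- rGamma (1 - z) * Digamma (1 - z)) * (-1) * rGamma z) (at z)"
    using nz by (auto intro!: derivative_eq_intros simp: algebra_simps)
  moreover have "((\<lambda>w. sin (of_real pi * w) / of_real pi) has_field_derivative cos (of_real pi * z)) (at z)"
    by (auto intro!: derivative_eq_intros)
  moreover have "rGamma w * rGamma (1 - w) = sin (of_real pi * w) / of_real pi" for w :: complex
    by (rule rGamma_reflection_complex)
  ultimately have "(- rGamma z * Digamma z) * rGamma (1 - z) + (- rGamma (1 - z) * Digamma (1 - z)) * (-1) * rGamma z
      = cos (of_real pi * z)"
    by (intro DERIV_unique[where f = "\<lambda>w. rGamma w * rGamma (1 - w)" and x = z]) simp_all
  then have "(rGamma z * rGamma (1 - z)) * (Digamma (1 - z) - Digamma z) = cos (of_real pi * z)"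
    by (simp add: algebra_simps)
  then have A: "sin (of_real pi * z) * (Digamma (1 - z) - Digamma z) = of_real pi * cos (of_real pi * z)"
    by (simp add: rGamma_reflection_complex field_simps)
  have sinz: "sin (of_real pi * z) = \<i> * of_real (sinh (pi * s))"
    "cos (of_real pi * z) = of_real (cosh (pi * s))"
    by (simp_all add: z_def sinh_field_def cosh_field_def sin_exp_eq' cos_exp_eq exp_of_real[symmetric] algebra_simps)
  \<comment> \<open>The recurrence replaces \<open>Digamma z\<close> by
    \<open>Digamma (1 + z)\<close> and produces the term \<open>1 / z\<close>. Euler's constant then
    cancels in the difference of the two series.\<close>
  have B: "Digamma (1 - z) - Digamma (1 + z) + 1 / z = of_real (pi * cosh (pi * s)) / (\<i> * of_real (sinh (pi * s)))"
    using A assms Digamma_plus1[OF z0] unfolding sinz by (simp add: field_simps add.commute)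
  have "(\<lambda>k. inverse (of_nat (Suc k)) - inverse (w + of_nat k)) sums (Digamma w + euler_mascheroni)" 
     if "w \<notin> \<int>\<^sub>\<le>\<^sub>0" for w :: complex
    using summable_Digamma[of w] that by (auto simp: Digamma_def sums_iff)
  from sums_diff[OF this[OF nz(2)] this[OF nz(3)]]
  have *: "(\<lambda>k. inverse (1 + z + of_nat k) - inverse (1 - z + of_nat k)) sums
     (of_real (pi * cosh (pi * s)) / (\<i> * of_real (sinh (pi * s))) - 1 / z)"
    unfolding B[symmetric] by simp
  have "(\<lambda>k. \<i> * (inverse (1 + z + of_nat k) - inverse (1 - z + of_nat k))) sums
      of_real (pi * cosh (pi * s) / sinh (pi * s) - 1 / s)"
  proof -
    have "\<i> * (of_real (pi * cosh (pi * s)) / (\<i> * of_real (sinh (pi * s))) - 1 / z) =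
        of_real (pi * cosh (pi * s) / sinh (pi * s) - 1 / s)"
      using assms by (simp add: z_def field_simps)
    with sums_mult[OF *, of \<i>] show ?thesis by simp
  qed
  moreover have "\<i> * (inverse (1 + z + of_nat k) - inverse (1 - z + of_nat k)) =
      of_real (2 * s / (s\<^sup>2 + (real (Suc k))\<^sup>2))" for k
  proof -
    have "1 + z + of_nat k \<noteq> 0" "1 - z + of_nat k \<noteq> 0" "s\<^sup>2 + (real (Suc k))\<^sup>2 \<noteq> 0"
      using assms by (auto simp: z_def complex_eq_iff add_nonneg_eq_0_iff)
    moreover have "(1 + z + of_nat k) * (1 - z + of_nat k) = of_real (s\<^sup>2 + (real (Suc k))\<^sup>2)"
      by (simp add: z_def algebra_simps power2_eq_square)
    moreover have "\<i> * ((1 - z + of_nat k) - (1 + z + of_nat k)) = of_real (2 * s)"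
      by (simp add: z_def)
    ultimately show ?thesis
      by (simp add: divide_simps right_diff_distrib)
  qed
  ultimately show ?thesis
    by (simp only: sums_of_real_iff)
qed

text \<open>The first and last terms of \<open>B_fun s\<close> add up to half of coth (pi s), so
  this is the previous expansion divided by 2 pi.\<close>

lemma B_fun_sums:
  assumes "s > 0"
  shows "(\<lambda>n. s / (s\<^sup>2 + (real (Suc n))\<^sup>2) / pi) sums B_fun s"
proof -
  have e: "exp (2 * pi * s) > 1" "exp (2 * pi * s) = exp (pi * s) * exp (pi * s)"
    using assms by (auto simp: mult_exp_exp)
  have "(cosh (pi * s) / sinh (pi * s)) / 2 = 1 / 2 + 1 / (exp (2 * pi * s) - 1)"
  proof -
    define E where "E = exp (pi * s)"
    have "E > 1" using assms by (simp add: E_def)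
    then have "E * E > 1" using less_1_mult by blast
    then show ?thesis
      using \<open>E > 1\<close> unfolding e(2) cosh_def sinh_def exp_minus E_def[symmetric]
      by (simp add: divide_simps) (simp add: algebra_simps)
  qed
  moreover have "(\<lambda>n. 2 * s / (s\<^sup>2 + (real (Suc n))\<^sup>2) / (2 * pi)) sums
      ((pi * cosh (pi * s) / sinh (pi * s) - 1 / s) / (2 * pi))"
    by (rule sums_divide, rule coth_partial_fractions) (use assms in simp)
  moreover have "(pi * cosh (pi * s) / sinh (pi * s) - 1 / s) / (2 * pi) =
      (cosh (pi * s) / sinh (pi * s)) / 2 - 1 / (2 * pi * s)"
    by (simp add: diff_divide_distrib)
  moreover have "2 * s / (s\<^sup>2 + (real (Suc n))\<^sup>2) / (2 * pi) = s / (s\<^sup>2 + (real (Suc n))\<^sup>2) / pi" for n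
    by simp
  ultimately show ?thesis
    unfolding B_fun_def by (simp only: add.commute diff_add_eq) (simp add: algebra_simps)
qed

section \<open>Cosine transforms\<close>

lemma pos_lborel_FTC_nonneg:
  fixes f F :: "real \<Rightarrow> real"
  assumes F: "\<And>t. t > 0 \<Longrightarrow> (F has_real_derivative f t) (at t)"
    and f: "\<And>t. t > 0 \<Longrightarrow> isCont f t" and nonneg: "\<And>t. t > 0 \<Longrightarrow> 0 \<le> f t"
    and A: "(F \<longlongrightarrow> A) (at_right 0)" and B: "(F \<longlongrightarrow> B) at_top"
  shows "integrable pos_lborel f" "integral\<^sup>L pos_lborel f = B - A"
proof -
  have e: "einterval 0 \<infinity> = {0<..}" by (auto simp: einterval_def zero_ereal_def)
  have *: "((F \<circ> real_of_ereal) \<longlongrightarrow> A) (at_right 0)" "((F \<circ> real_of_ereal) \<longlongrightarrow> B) (at_left \<infinity>)"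
    using A B by (simp_all add: zero_ereal_def ereal_tendsto_simps)
  note FTC = interval_integral_FTC_nonneg[of 0 \<infinity> F f A B, OF _ _ _ _ *]
  show "integrable pos_lborel f"
    unfolding integrable_pos_lborel_iff using FTC(1) F f nonneg unfolding e by simp
  show "integral\<^sup>L pos_lborel f = B - A"
    unfolding integral_pos_lborel using FTC(2) F f nonneg
    by (simp add: interval_lebesgue_integral_0_infty)
qed

lemma integral_inverse_add_squares:
  assumes "a > 0"
  shows "integrable pos_lborel (\<lambda>t. 1 / (a\<^sup>2 + t\<^sup>2))" "integral\<^sup>L pos_lborel (\<lambda>t. 1 / (a\<^sup>2 + t\<^sup>2)) = pi / (2 * a)"
proof -
  have nz: "a\<^sup>2 + t\<^sup>2 \<noteq> 0" for t using assms by (auto simp: add_nonneg_eq_0_iff)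
  have F: "((\<lambda>t. arctan (t / a) / a) has_real_derivative 1 / (a\<^sup>2 + t\<^sup>2)) (at t)" for t
    using assms nz[of t] by (auto intro!: derivative_eq_intros simp: divide_simps power2_eq_square)
  have "isCont (\<lambda>t. 1 / (a\<^sup>2 + t\<^sup>2)) t" for t using nz by (auto intro!: continuous_intros)
  moreover have "((\<lambda>t. arctan (t / a) / a) \<longlongrightarrow> 0) (at_right 0)"
    using assms by (auto intro!: tendsto_eq_intros)
  moreover have "((\<lambda>t. arctan (t / a) / a) \<longlongrightarrow> pi / 2 / a) at_top"
  proof -
    have "filterlim (\<lambda>t. t / a) at_top at_top"
      using assms filterlim_tendsto_pos_mult_at_top[OF tendsto_const[of "1 / a"] _ filterlim_ident]
      by (simp add: mult.commute)
    then show ?thesis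
      by (intro tendsto_divide filterlim_compose[OF tendsto_arctan_at_top]) (use assms in auto)
  qed
  ultimately show "integrable pos_lborel (\<lambda>t. 1 / (a\<^sup>2 + t\<^sup>2))"
      "integral\<^sup>L pos_lborel (\<lambda>t. 1 / (a\<^sup>2 + t\<^sup>2)) = pi / (2 * a)"
    using pos_lborel_FTC_nonneg[of "\<lambda>t. arctan (t / a) / a" "\<lambda>t. 1 / (a\<^sup>2 + t\<^sup>2)" 0 "pi / 2 / a"] F
    by (auto simp: add_nonneg_nonneg)
qed

text \<open>Majorant for sin (c t) / t times a function of order 1 / (1 + t): it behaves like
  t^(-1/2) at 0 and like t^(-3/2) at infinity.\<close>

lemma integrable_inverse_sqrt_mult_add_one:
  "integrable pos_lborel (\<lambda>t. 1 / (sqrt t * (1 + t)))"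
proof (rule pos_lborel_FTC_nonneg)
  show "((\<lambda>t. 2 * arctan (sqrt t)) has_real_derivative 1 / (sqrt t * (1 + t))) (at t)" if "t > 0" for t
    using that by (auto intro!: derivative_eq_intros simp: divide_simps)
  show "((\<lambda>t. 2 * arctan (sqrt t)) \<longlongrightarrow> 2 * arctan (sqrt 0)) (at_right 0)"
    by (intro tendsto_intros)
  show "((\<lambda>t. 2 * arctan (sqrt t)) \<longlongrightarrow> 2 * (pi / 2)) at_top"
    by (intro tendsto_mult tendsto_const filterlim_compose[OF tendsto_arctan_at_top sqrt_at_top])
qed (auto intro!: continuous_intros)

text \<open>Partial fractions in u^2 reduce this to two arctangent integrals. The decomposition
  divides by \<open>a\<^sup>2 - s\<^sup>2\<close>; in the application \<open>s\<close> is
  \<open>a * t\<close>, so the excluded case is the single point t = 1.\<close>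

lemma integral_product_of_quadratics:
  assumes "a > 0" "s > 0" "a \<noteq> s"
  shows "integrable pos_lborel (\<lambda>u. u\<^sup>2 / ((s\<^sup>2 + u\<^sup>2) * (a\<^sup>2 + u\<^sup>2)))"
    "integral\<^sup>L pos_lborel (\<lambda>u. u\<^sup>2 / ((s\<^sup>2 + u\<^sup>2) * (a\<^sup>2 + u\<^sup>2))) = pi / (2 * (a + s))"
proof -
  have nz: "a\<^sup>2 - s\<^sup>2 \<noteq> 0" using assms by (simp add: power2_eq_iff)
  have *: "u\<^sup>2 / ((s\<^sup>2 + u\<^sup>2) * (a\<^sup>2 + u\<^sup>2)) =
      (a\<^sup>2 * (1 / (a\<^sup>2 + u\<^sup>2)) - s\<^sup>2 * (1 / (s\<^sup>2 + u\<^sup>2))) / (a\<^sup>2 - s\<^sup>2)" for u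
  proof -
    have "s\<^sup>2 + u\<^sup>2 \<noteq> 0" "a\<^sup>2 + u\<^sup>2 \<noteq> 0" using assms by (auto simp: add_nonneg_eq_0_iff)
    then show ?thesis using nz by (simp add: divide_simps) (simp add: algebra_simps)
  qed
  note I = integral_inverse_add_squares[OF assms(1)] integral_inverse_add_squares[OF assms(2)]
  show "integrable pos_lborel (\<lambda>u. u\<^sup>2 / ((s\<^sup>2 + u\<^sup>2) * (a\<^sup>2 + u\<^sup>2)))"
    unfolding *
    by (intro integrable_divide Bochner_Integration.integrable_diff integrable_mult_right) (use I in simp_all)
  have "integral\<^sup>L pos_lborel (\<lambda>u. u\<^sup>2 / ((s\<^sup>2 + u\<^sup>2) * (a\<^sup>2 + u\<^sup>2))) =
      (a\<^sup>2 * (pi / (2 * a)) - s\<^sup>2 * (pi / (2 * s))) / (a\<^sup>2 - s\<^sup>2)"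
    unfolding * integral_divide_zero
    by (subst Bochner_Integration.integral_diff) (use I in \<open>auto simp del: times_divide_eq_right\<close>)
  also have "\<dots> = (pi / 2 * (a - s)) / ((a - s) * (a + s))"
  proof -
    have "a\<^sup>2 * (pi / (2 * a)) = pi / 2 * a" "s\<^sup>2 * (pi / (2 * s)) = pi / 2 * s"
      using assms by (simp_all add: power2_eq_square)
    moreover have "a\<^sup>2 - s\<^sup>2 = (a - s) * (a + s)" by (simp add: power2_eq_square algebra_simps)
    ultimately show ?thesis by (simp only: right_diff_distrib)
  qed
  finally show "integral\<^sup>L pos_lborel (\<lambda>u. u\<^sup>2 / ((s\<^sup>2 + u\<^sup>2) * (a\<^sup>2 + u\<^sup>2))) = pi / (2 * (a + s))"
    using assms by simp
qed

text \<open>Dirichlet's argument: integrating the kernel \<open>sin (T d) / d\<close> by parts against \<open>Si\<close>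
  needs only \<open>Si\<close> bounded and \<open>Si \<longlongrightarrow> pi / 2\<close>.\<close>

lemma integral_cosine_transform:
  fixes g g' F :: "real \<Rightarrow> real"
  assumes c: "0 < c"
    and g: "\<And>d. (g has_real_derivative g' d) (at d)" and g': "continuous_on UNIV g'"
    and F: "integrable pos_lborel F"
    and eq: "AE t in pos_lborel. F t = integral {0..c} (\<lambda>d. g d * cos (d * t))"
  shows "integral\<^sup>L pos_lborel F = pi / 2 * g 0"
proof -
  define H where "H t = integral {0..c} (\<lambda>d. g d * cos (d * t))" for t
  have contg: "continuous_on S g" for S
    using g by (meson DERIV_isCont continuous_at_imp_continuous_on)
  have contg': "continuous_on S g'" for S
    using g' continuous_on_subset by blast
  have cont2: "continuous_on S (\<lambda>(t, d). g d * cos (d * t))" for S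
    unfolding split_beta
    by (intro continuous_intros continuous_on_compose2[OF contg[of UNIV]]) auto
  have contH: "continuous_on S H" for S
    using integral_continuous_on_param[OF cont2, of S 0 c] by (simp add: H_def[abs_def])
  \<comment> \<open>After truncation at \<open>T\<close> the two integrals may be swapped. The inner
    one becomes \<open>T * sinc (T * d)\<close>, whose primitive in \<open>d\<close> is
    \<open>Si (T * d)\<close>, and integration by parts moves the derivative to
    \<open>g\<close>.\<close>
  have trunc: "integral\<^sup>L pos_lborel (\<lambda>t. indicator {..T} t * F t) =
      g c * Si (T * c) - integral {0..c} (\<lambda>d. g' d * Si (T * d))" if T: "T > 0" for T
  proof -
    have [measurable]: "H \<in> borel_measurable borel"
      using contH by (rule borel_measurable_continuous_onI)
    have "integral\<^sup>L pos_lborel (\<lambda>t. indicator {..T} t * F t) = integral\<^sup>L pos_lborel (\<lambda>t. indicator {..T} t * H t)"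
    proof (rule integral_cong_AE)
      show "(\<lambda>t. indicator {..T} t * F t) \<in> borel_measurable pos_lborel"
        using F by (intro borel_measurable_times[OF borel_measurable_pos_lborel]) auto
      show "AE t in pos_lborel. indicator {..T} t * F t = indicator {..T} t * H t"
        using eq by eventually_elim (simp add: H_def)
    qed (intro borel_measurable_pos_lborel, measurable)
    also have "\<dots> = (LINT t:{0..T}|lborel. H t)"
      unfolding integral_pos_lborel set_lebesgue_integral_def
      using AE_lborel_singleton[of 0]
      by (intro integral_cong_AE) (auto split: split_indicator)
    also have "\<dots> = integral {0..T} H"
      by (intro set_borel_integral_eq_integral borel_integrable_atLeastAtMost' contH)
    also have "\<dots> = integral {0..c} (\<lambda>d. integral {0..T} (\<lambda>t. g d * cos (d * t)))"
      unfolding H_def[abs_def]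
      using integral_swap_continuous[where f="\<lambda>t d. g d * cos (d * t)" and a=0 and b=T and c=0 and d=c]
        cont2 by simp
    also have "\<dots> = integral {0..c} (\<lambda>d. g d * (T * sinc (T * d)))"
    proof (rule Henstock_Kurzweil_Integration.integral_cong)
      fix d
      have "((\<lambda>t. cos (d * t)) has_integral T * sinc (T * d)) {0..T}"
      proof (cases "d = 0")
        case True
        then show ?thesis using has_integral_const_real[of "1::real" 0 T] T by simp
      next
        case False
        then have "((\<lambda>t. cos (d * t)) has_integral sin (d * T) / d - sin (d * 0) / d) {0..T}"
          using T by (intro fundamental_theorem_of_calculus)
            (auto intro!: derivative_eq_intros simp flip: has_real_derivative_iff_has_vector_derivative)
        then show ?thesis using False T by (simp add: mult.commute)
      qed
      from has_integral_mult_right[OF this, of "g d"]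
      show "integral {0..T} (\<lambda>t. g d * cos (d * t)) = g d * (T * sinc (T * d))"
        by (rule integral_unique)
    qed
    also have "\<dots> = g c * Si (T * c) - integral {0..c} (\<lambda>d. g' d * Si (T * d))"
    proof -
      have SiT: "((\<lambda>d. Si (T * d)) has_real_derivative T * sinc (T * d)) (at d)" for d
        using DERIV_chain2[of Si "sinc (T * d)" "\<lambda>d. T * d" d T UNIV, OF DERIV_Si DERIV_cmult_Id]
        by (simp only: mult.commute)
      have "((\<lambda>d. g d * (T * sinc (T * d)) + g' d * Si (T * d)) has_integral
          g c * Si (T * c) - g 0 * Si (T * 0)) {0..c}"
      proof (rule fundamental_theorem_of_calculus)
        fix d
        have "((\<lambda>d. g d * Si (T * d)) has_real_derivative g' d * Si (T * d) + (T * sinc (T * d)) * g d) (at d)"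
          by (intro DERIV_mult g SiT)
        then show "((\<lambda>d. g d * Si (T * d)) has_vector_derivative g d * (T * sinc (T * d)) + g' d * Si (T * d))
            (at d within {0..c})"
          unfolding has_real_derivative_iff_has_vector_derivative[symmetric]
          by (simp only: mult.commute add.commute has_field_derivative_at_within)
      qed (use c in simp)
      \<comment> \<open>Removes the boundary term at \<open>d = 0\<close>; the value
        \<open>g 0\<close> only reappears in the limit.\<close>
      moreover have "Si 0 = 0" by (simp add: Si_def zero_ereal_def)
      moreover have int: "(\<lambda>d. g' d * Si (T * d)) integrable_on {0..c}"
        using DERIV_isCont[OF SiT]
        by (intro integrable_continuous_real continuous_intros contg' continuous_at_imp_continuous_on ballI) auto
      ultimately have "((\<lambda>d. (g d * (T * sinc (T * d)) + g' d * Si (T * d)) - g' d * Si (T * d)) has_integral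
          g c * Si (T * c) - integral {0..c} (\<lambda>d. g' d * Si (T * d))) {0..c}"
        by (intro has_integral_diff) (auto simp: integrable_integral)
      then show ?thesis by (simp add: integral_unique)
    qed
    finally show ?thesis .
  qed
  \<comment> \<open>Absolute integrability of \<open>F\<close> dominates the truncations.\<close>
  have lim1: "((\<lambda>T. integral\<^sup>L pos_lborel (\<lambda>t. indicator {..T} t * F t)) \<longlongrightarrow> integral\<^sup>L pos_lborel F) at_top"
  proof (rule integral_dominated_convergence_at_top[where w = "\<lambda>t. norm (F t)"])
    show "AE x in pos_lborel. ((\<lambda>T. indicator {..T} x * F x) \<longlongrightarrow> F x) at_top"
    proof (rule AE_I2)
      fix x
      have "\<forall>\<^sub>F T in at_top. indicator {..T} x * F x = F x"
        using eventually_ge_at_top[of x] by eventually_elim simp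
      then show "((\<lambda>T. indicator {..T} x * F x) \<longlongrightarrow> F x) at_top"
        by (rule tendsto_eventually)
    qed
    show "(\<lambda>t. indicator {..T} t * F t) \<in> borel_measurable pos_lborel" for T
      using F by (intro borel_measurable_times[OF borel_measurable_pos_lborel]) auto
  qed (use F in \<open>auto intro!: always_eventually split: split_indicator\<close>)
  \<comment> \<open>For every \<open>d > 0\<close>, hence almost everywhere,
    \<open>Si (T * d)\<close> tends to pi / 2, and it is bounded. The integral of \<open>g'\<close>
    is \<open>g c - g 0\<close>, so the contributions of \<open>g c\<close> cancel.\<close>
  have lim2: "((\<lambda>T. g c * Si (T * c) - integral {0..c} (\<lambda>d. g' d * Si (T * d))) \<longlongrightarrow> pi / 2 * g 0) at_top"
  proof -
    obtain C where C: "\<And>T. \<bar>Si T\<bar> \<le> C" using bounded_Si by blast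
    have SiT: "((\<lambda>T. Si (T * d)) \<longlongrightarrow> pi / 2) at_top" if "d > 0" for d
      by (rule filterlim_compose[OF Si_at_top])
         (use that filterlim_tendsto_pos_mult_at_top[OF tendsto_const[of d] _ filterlim_ident] in \<open>simp add: mult.commute\<close>)
    have cSi: "continuous_on S (\<lambda>d. g' d * Si (T * d))" for S T
      by (intro continuous_intros contg' continuous_on_compose2[OF continuous_at_imp_continuous_on[of UNIV Si]])
         (auto intro: isCont_Si)
    have [measurable]: "g' \<in> borel_measurable borel"
      using g' by (rule borel_measurable_continuous_onI)
    have I: "set_integrable lborel {0..c} (\<lambda>d. \<bar>g' d\<bar> * C)"
      by (intro borel_integrable_atLeastAtMost' continuous_intros contg')
    have "((\<lambda>T. LINT d:{0..c}|lborel. g' d * Si (T * d)) \<longlongrightarrow> (LINT d:{0..c}|lborel. g' d * (pi / 2))) at_top"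
      unfolding set_lebesgue_integral_def
    proof (rule integral_dominated_convergence_at_top[OF _ _ I[unfolded set_integrable_def]])
      show "AE x in lborel. ((\<lambda>T. indicator {0..c} x *\<^sub>R (g' x * Si (T * x))) \<longlongrightarrow>
          indicator {0..c} x *\<^sub>R (g' x * (pi / 2))) at_top"
        using AE_lborel_singleton[of 0]
        by eventually_elim (auto intro!: tendsto_mult[OF tendsto_const SiT] simp del: times_divide_eq_right
          split: split_indicator)
      show "\<forall>\<^sub>F T in at_top. AE x in lborel. norm (indicator {0..c} x *\<^sub>R (g' x * Si (T * x)))
          \<le> indicator {0..c} x *\<^sub>R (\<bar>g' x\<bar> * C)"
        by (intro always_eventually allI AE_I2)
           (auto simp: abs_mult C intro!: mult_left_mono split: split_indicator)
    qed auto
    also have "(LINT d:{0..c}|lborel. g' d * (pi / 2)) = integral {0..c} (\<lambda>d. g' d * (pi / 2))"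
      by (intro set_borel_integral_eq_integral borel_integrable_atLeastAtMost' continuous_intros contg')
    also have "\<dots> = (g c - g 0) * (pi / 2)"
    proof -
      have "(g' has_integral g c - g 0) {0..c}"
        using c g by (intro fundamental_theorem_of_calculus)
          (auto simp flip: has_real_derivative_iff_has_vector_derivative simp: has_field_derivative_at_within)
      then show ?thesis by (intro integral_unique has_integral_mult_left)
    qed
    also have "(\<lambda>T. LINT d:{0..c}|lborel. g' d * Si (T * d)) = (\<lambda>T. integral {0..c} (\<lambda>d. g' d * Si (T * d)))"
      by (intro ext set_borel_integral_eq_integral borel_integrable_atLeastAtMost' cSi)
    finally have "((\<lambda>T. g c * Si (T * c) - integral {0..c} (\<lambda>d. g' d * Si (T * d))) \<longlongrightarrow>
        g c * (pi / 2) - (g c - g 0) * (pi / 2)) at_top"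
      by (intro tendsto_diff tendsto_mult tendsto_const SiT c)
    moreover have "g c * (pi / 2) - (g c - g 0) * (pi / 2) = pi / 2 * g 0" by (simp add: field_simps)
    ultimately show ?thesis by (simp only:)
  qed
  have "\<forall>\<^sub>F T in at_top. integral\<^sup>L pos_lborel (\<lambda>t. indicator {..T} t * F t) =
      g c * Si (T * c) - integral {0..c} (\<lambda>d. g' d * Si (T * d))"
    using eventually_gt_at_top[of 0] by eventually_elim (rule trunc)
  with lim1 have "((\<lambda>T. g c * Si (T * c) - integral {0..c} (\<lambda>d. g' d * Si (T * d))) \<longlongrightarrow> integral\<^sup>L pos_lborel F) at_top"
    by (rule Lim_transform_eventually)
  from tendsto_unique[OF _ this lim2] show ?thesis by simp
qed

section \<open>Two explicit cosine transforms\<close>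

text \<open>Representing the quotient as a finite cosine transform removes the singularity at t = 1:
  it bounds the quotient near that point, and it yields the integral over t through the value 1 -
  cos c of the transformed function at d = 0.\<close>

lemma integral_one_minus_cos_mult_cos:
  fixes c t :: real
  assumes "0 < c" "0 < t" "t \<noteq> 1"
  shows "integral {0..c} (\<lambda>d. (1 - cos (c - d)) * cos (d * t)) = (sin (c * t) / t - sin c) / (1 - t\<^sup>2)"
proof -
  have t: "t\<^sup>2 - 1 \<noteq> 0" using assms by (simp add: power2_eq_1_iff)
  define A where "A d = sin (d * t) / t - (t * cos (c - d) * sin (d * t) + sin (c - d) * cos (d * t)) / (t\<^sup>2 - 1)" for d
  have "((\<lambda>d. (1 - cos (c - d)) * cos (d * t)) has_integral A c - A 0) {0..c}"
  proof (rule fundamental_theorem_of_calculus)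
    fix d
    have "((\<lambda>d. t * cos (c - d) * sin (d * t) + sin (c - d) * cos (d * t)) has_real_derivative
        (t\<^sup>2 - 1) * (cos (c - d) * cos (d * t))) (at d within {0..c})"
      by (auto intro!: derivative_eq_intros simp: algebra_simps power2_eq_square)
    moreover have "((\<lambda>d. sin (d * t) / t) has_real_derivative cos (d * t)) (at d within {0..c})"
      using assms by (auto intro!: derivative_eq_intros)
    ultimately have "(A has_real_derivative cos (d * t) - ((t\<^sup>2 - 1) * (cos (c - d) * cos (d * t))) / (t\<^sup>2 - 1)) (at d within {0..c})"
      unfolding A_def by (intro DERIV_diff DERIV_cdivide)
    also have "cos (d * t) - ((t\<^sup>2 - 1) * (cos (c - d) * cos (d * t))) / (t\<^sup>2 - 1) = (1 - cos (c - d)) * cos (d * t)"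
      by (simp only: nonzero_mult_div_cancel_left[OF t]) (simp add: algebra_simps)
    finally show "(A has_vector_derivative (1 - cos (c - d)) * cos (d * t)) (at d within {0..c})"
      by (simp add: has_real_derivative_iff_has_vector_derivative)
  qed (use assms in simp)
  moreover have "A c - A 0 = (sin (c * t) / t - sin c) / (1 - t\<^sup>2)"
  proof -
    have "1 - t\<^sup>2 \<noteq> 0" using t by simp
    then show ?thesis
      using t assms by (simp add: A_def divide_simps) (simp add: algebra_simps power2_eq_square)
  qed
  ultimately show ?thesis by (simp add: integral_unique)
qed

text \<open>Up to t = 2 the transform gives the bound 2 c, and 1 + t^2 is at most 5, whence the
  constant 10. Beyond t = 2 the numerator is at most 2 and the denominator suffices. At t = 1 the
  left side is 0 by division by zero. The form \<open>1\<^sup>2 + t\<^sup>2\<close> matches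
  \<open>integral_inverse_add_squares\<close>.\<close>

lemma sin_quotient_bound:
  fixes c t :: real
  assumes "0 < c" "0 < t"
  shows "\<bar>(sin (c * t) / t - sin c) / (1 - t\<^sup>2)\<bar> \<le> 10 * (1 + c) * (1 / (1\<^sup>2 + t\<^sup>2))"
proof (cases "t = 1 \<or> t > 2")
  case False
  then have True: "t \<le> 2" "t \<noteq> 1" by auto
  have "norm (integral {0..c} (\<lambda>d. (1 - cos (c - d)) * cos (d * t))) \<le> integral {0..c} (\<lambda>d. 2)"
  proof (rule integral_norm_bound_integral)
    fix d
    have "\<bar>1 - cos (c - d)\<bar> * \<bar>cos (d * t)\<bar> \<le> 2 * 1"
      by (intro mult_mono) (use abs_cos_le_one[of "c - d"] in auto)
    then show "norm ((1 - cos (c - d)) * cos (d * t)) \<le> 2" by (simp add: abs_mult)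
  qed (auto intro!: integrable_continuous_real continuous_intros)
  also have "\<dots> = 2 * c" using assms by simp
  finally have "\<bar>(sin (c * t) / t - sin c) / (1 - t\<^sup>2)\<bar> \<le> 2 * c"
    using assms True by (simp add: integral_one_minus_cos_mult_cos)
  also have "\<dots> \<le> 10 * (1 + c) * (1 / (1\<^sup>2 + t\<^sup>2))"
  proof -
    have "t\<^sup>2 \<le> 2\<^sup>2" using True assms by (intro power_mono) auto
    then have "2 * c * (1\<^sup>2 + t\<^sup>2) \<le> 2 * c * 5" using assms by (intro mult_left_mono) auto
    then show ?thesis by (simp add: field_simps add_pos_nonneg)
  qed
  finally show ?thesis .
next
  case True
  show ?thesis
  proof (cases "t = 1")
    case False
    then have t: "t > 2" using True by simp
    then have t2: "t\<^sup>2 > 4" using power_strict_mono[of 2 t 2] by simp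
    have "\<bar>sin (c * t)\<bar> \<le> t" using t abs_sin_le_one[of "c * t"] by linarith
    then have "\<bar>sin (c * t) / t\<bar> \<le> 1" using t by (simp add: abs_divide divide_le_eq)
    then have "\<bar>sin (c * t) / t - sin c\<bar> \<le> 2" using abs_sin_le_one[of c] by linarith
    then have "\<bar>(sin (c * t) / t - sin c) / (1 - t\<^sup>2)\<bar> \<le> 2 / (t\<^sup>2 - 1)"
      unfolding abs_divide using t2 by (auto intro!: divide_right_mono)
    also have "\<dots> \<le> 10 * (1 / (1\<^sup>2 + t\<^sup>2))"
      using t2 by (simp add: field_simps)
    also have "\<dots> \<le> 10 * (1 + c) * (1 / (1\<^sup>2 + t\<^sup>2))"
      using assms by (intro mult_right_mono) auto
    finally show ?thesis .
  qed (use assms in simp)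
qed

lemma integral_sin_quotient:
  fixes c :: real
  assumes "0 < c"
  defines "D \<equiv> (\<lambda>t. (sin (c * t) / t - sin c) / (1 - t\<^sup>2))"
  shows "integrable pos_lborel D" "integral\<^sup>L pos_lborel D = pi / 2 * (1 - cos c)"
proof -
  have I: "integrable pos_lborel (\<lambda>t. 10 * (1 + c) * (1 / (1\<^sup>2 + t\<^sup>2)))"
    by (intro integrable_mult_right integral_inverse_add_squares) simp
  have bd: "AE t in pos_lborel. \<bar>D t\<bar> \<le> 10 * (1 + c) * (1 / (1\<^sup>2 + t\<^sup>2))"
    using AE_space
    by eventually_elim (use assms sin_quotient_bound in \<open>auto simp: D_def space_restrict_space\<close>)
  have D_meas: "D \<in> borel_measurable pos_lborel"
    unfolding D_def by (intro borel_measurable_pos_lborel) measurable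
  show D: "integrable pos_lborel D"
  proof (rule Bochner_Integration.integrable_bound[OF I D_meas])
    show "AE t in pos_lborel. norm (D t) \<le> norm (10 * (1 + c) * (1 / (1\<^sup>2 + t\<^sup>2)))"
      using bd by eventually_elim (use assms(1) in simp)
  qed
  have "integral\<^sup>L pos_lborel D = pi / 2 * (1 - cos (c - 0))"
  proof (rule integral_cosine_transform[OF assms(1) _ _ D])
    show "((\<lambda>d. 1 - cos (c - d)) has_real_derivative - sin (c - d)) (at d)" for d
      by (auto intro!: derivative_eq_intros)
    show "AE t in pos_lborel. D t = integral {0..c} (\<lambda>d. (1 - cos (c - d)) * cos (d * t))"
      using AE_pos_lborel_neq[of 1] AE_space
      by eventually_elim (use assms in \<open>auto simp: D_def space_restrict_space integral_one_minus_cos_mult_cos\<close>)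
  qed (auto intro!: continuous_intros)
  then show "integral\<^sup>L pos_lborel D = pi / 2 * (1 - cos c)" by simp
qed

text \<open>The transformed function g satisfies g'' = u^2 g + 1 and vanishes at d = b together with
  g', so two integrations by parts leave only g'(0) = - sinh (u b) / u and the integral of cos (d
  s).\<close>

lemma integral_cosh_mult_cos:
  fixes b u s :: real
  assumes "0 < b" "0 < u" "0 < s"
  shows "integral {0..b} (\<lambda>d. ((cosh (u * (b - d)) - 1) / u\<^sup>2) * cos (d * s)) =
    (sinh (u * b) / u - sin (b * s) / s) / (u\<^sup>2 + s\<^sup>2)"
proof -
  have nz: "u\<^sup>2 + s\<^sup>2 \<noteq> 0" using assms by (simp add: add_nonneg_eq_0_iff)
  define A where "A d = ((s * cosh (u * (b - d)) * sin (d * s) - u * sinh (u * (b - d)) * cos (d * s)) / (u\<^sup>2 + s\<^sup>2) -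
    sin (d * s) / s) / u\<^sup>2" for d
  have "((\<lambda>d. ((cosh (u * (b - d)) - 1) / u\<^sup>2) * cos (d * s)) has_integral A b - A 0) {0..b}"
  proof (rule fundamental_theorem_of_calculus)
    fix d
    have "((\<lambda>d. s * cosh (u * (b - d)) * sin (d * s) - u * sinh (u * (b - d)) * cos (d * s)) has_real_derivative
        (u\<^sup>2 + s\<^sup>2) * (cosh (u * (b - d)) * cos (d * s))) (at d within {0..b})"
      by (auto intro!: derivative_eq_intros simp: algebra_simps power2_eq_square)
    moreover have "((\<lambda>d. sin (d * s) / s) has_real_derivative cos (d * s)) (at d within {0..b})"
      using assms by (auto intro!: derivative_eq_intros)
    ultimately have "(A has_real_derivative ((u\<^sup>2 + s\<^sup>2) * (cosh (u * (b - d)) * cos (d * s)) / (u\<^sup>2 + s\<^sup>2) - cos (d * s)) / u\<^sup>2) (at d within {0..b})"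
      unfolding A_def by (intro DERIV_diff DERIV_cdivide)
    also have "((u\<^sup>2 + s\<^sup>2) * (cosh (u * (b - d)) * cos (d * s)) / (u\<^sup>2 + s\<^sup>2) - cos (d * s)) / u\<^sup>2 =
        ((cosh (u * (b - d)) - 1) / u\<^sup>2) * cos (d * s)"
      by (simp only: nonzero_mult_div_cancel_left[OF nz]) (simp add: algebra_simps)
    finally show "(A has_vector_derivative ((cosh (u * (b - d)) - 1) / u\<^sup>2) * cos (d * s)) (at d within {0..b})"
      by (simp add: has_real_derivative_iff_has_vector_derivative)
  qed (use assms in simp)
  moreover have "A b - A 0 = (sinh (u * b) / u - sin (b * s) / s) / (u\<^sup>2 + s\<^sup>2)"
    using nz assms by (simp add: A_def divide_simps) (simp add: algebra_simps power2_eq_square)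
  ultimately show ?thesis by (metis integral_unique)
qed

lemma abs_sin_divide_le: "t > 0 \<Longrightarrow> c \<ge> 0 \<Longrightarrow> \<bar>sin (c * t) / t\<bar> \<le> c" for c t :: real
  using abs_sin_x_le_abs_x[of "c * t"] by (simp add: abs_divide abs_mult divide_le_eq)

text \<open>The cosine transform evaluates the difference \<open>F\<close> of an arctangent
  integrand and the wanted one. Subtracting the arctangent integral turns cosh (u b) into cosh (u b)
  - sinh (u b) = exp (- b u).\<close>

lemma integral_sin_divide_quadratic:
  fixes b u :: real
  assumes "0 < b" "0 < u"
  shows "integrable pos_lborel (\<lambda>s. sin (b * s) / s * (1 / (u\<^sup>2 + s\<^sup>2)))"
    "integral\<^sup>L pos_lborel (\<lambda>s. sin (b * s) / s * (1 / (u\<^sup>2 + s\<^sup>2))) = pi / 2 * (1 - exp (- (b * u))) / u\<^sup>2"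
proof -
  note J = integral_inverse_add_squares[OF assms(2)]
  have "integrable pos_lborel (\<lambda>s. b * (1 / (u\<^sup>2 + s\<^sup>2)))"
    by (intro integrable_mult_right J)
  then show I: "integrable pos_lborel (\<lambda>s. sin (b * s) / s * (1 / (u\<^sup>2 + s\<^sup>2)))"
  proof (rule Bochner_Integration.integrable_bound)
    show "(\<lambda>s. sin (b * s) / s * (1 / (u\<^sup>2 + s\<^sup>2))) \<in> borel_measurable pos_lborel"
      by (intro borel_measurable_pos_lborel) measurable
    have "norm (sin (b * s) / s * (1 / (u\<^sup>2 + s\<^sup>2))) \<le> norm (b * (1 / (u\<^sup>2 + s\<^sup>2)))" if "s > 0" for s
      unfolding norm_mult using abs_sin_divide_le[OF that, of b] assms
      by (intro mult_right_mono) auto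
    then show "AE s in pos_lborel. norm (sin (b * s) / s * (1 / (u\<^sup>2 + s\<^sup>2))) \<le> norm (b * (1 / (u\<^sup>2 + s\<^sup>2)))"
      by (intro AE_I2) (auto simp: space_restrict_space)
  qed
  define F where "F s = sinh (u * b) / u * (1 / (u\<^sup>2 + s\<^sup>2)) - sin (b * s) / s * (1 / (u\<^sup>2 + s\<^sup>2))" for s
  have intF: "integrable pos_lborel F"
    unfolding F_def by (intro Bochner_Integration.integrable_diff integrable_mult_right J I)
  have "integral\<^sup>L pos_lborel F = pi / 2 * ((cosh (u * (b - 0)) - 1) / u\<^sup>2)"
  proof (rule integral_cosine_transform[OF assms(1) _ _ intF])
    show "((\<lambda>d. (cosh (u * (b - d)) - 1) / u\<^sup>2) has_real_derivative - sinh (u * (b - d)) / u) (at d)" for d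
      using assms by (auto intro!: derivative_eq_intros simp: power2_eq_square)
    show "AE s in pos_lborel. F s = integral {0..b} (\<lambda>d. ((cosh (u * (b - d)) - 1) / u\<^sup>2) * cos (d * s))"
    proof (rule AE_I2)
      fix s assume "s \<in> space pos_lborel"
      then show "F s = integral {0..b} (\<lambda>d. ((cosh (u * (b - d)) - 1) / u\<^sup>2) * cos (d * s))"
        using assms by (subst integral_cosh_mult_cos) (auto simp: space_restrict_space F_def diff_divide_distrib)
    qed
  qed (use assms in \<open>auto intro!: continuous_intros\<close>)
  moreover have "integral\<^sup>L pos_lborel F = sinh (u * b) / u * (pi / (2 * u)) -
      integral\<^sup>L pos_lborel (\<lambda>s. sin (b * s) / s * (1 / (u\<^sup>2 + s\<^sup>2)))"
    unfolding F_def J(2)[symmetric]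
    by (subst Bochner_Integration.integral_diff)
       (use I J in \<open>auto intro!: integrable_mult_right simp del: times_divide_eq_right\<close>)
  moreover have "cosh (u * b) = sinh (u * b) + exp (- (b * u))"
    by (simp add: cosh_def sinh_def mult.commute field_simps)
  ultimately show "integral\<^sup>L pos_lborel (\<lambda>s. sin (b * s) / s * (1 / (u\<^sup>2 + s\<^sup>2))) = pi / 2 * (1 - exp (- (b * u))) / u\<^sup>2"
    using assms by (simp add: field_simps power2_eq_square)
qed

section \<open>The Bose function\<close>

definition bose :: "real \<Rightarrow> real" where
  "bose s = 1 / (exp (2 * pi * s) - 1)"

lemma bose_pos: "s > 0 \<Longrightarrow> bose s > 0"
  by (simp add: bose_def)

lemma B_fun_eq: "B_fun s = bose s - 1 / (2 * pi * s) + 1 / 2"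
  by (simp add: B_fun_def bose_def)

lemma borel_measurable_bose [measurable]: "bose \<in> borel_measurable borel"
  unfolding bose_def by measurable

text \<open>With y = 2 pi x the derivative has the sign of exp y - 1 - y exp y, which is nonpositive
  because 1 - y is at most exp (- y). This decides the sign of \<open>bose_quot\<close>.\<close>

lemma antimono_mult_bose:
  assumes "0 < s" "s \<le> r"
  shows "r * bose r \<le> s * bose s"
proof (rule DERIV_nonpos_imp_nonincreasing[of s r "\<lambda>x. x * bose x", OF assms(2)])
  fix x assume "s \<le> x" "x \<le> r"
  then have x: "x > 0" using assms by simp
  define y where "y = 2 * pi * x"
  have y: "y > 0" using x by (simp add: y_def)
  have "exp y - 1 \<noteq> 0" using y by simp
  then have "((\<lambda>x. x * bose x) has_real_derivative (exp y - 1 - y * exp y) / (exp y - 1)\<^sup>2) (at x)"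
    unfolding bose_def y_def
    by (auto intro!: derivative_eq_intros simp: field_simps power2_eq_square)
  moreover have "exp y - 1 - y * exp y \<le> 0"
  proof -
    have "(1 - y) * exp y \<le> exp (- y) * exp y"
      using exp_ge_add_one_self[of "- y"] by (intro mult_right_mono) auto
    then show ?thesis by (simp add: mult_exp_exp algebra_simps)
  qed
  ultimately show "\<exists>z. ((\<lambda>x. x * bose x) has_real_derivative z) (at x) \<and> z \<le> 0"
    by (auto intro!: exI divide_nonpos_nonneg)
qed

text \<open>This is y \<le> 2 sinh (y / 2) multiplied by exp (y / 2).\<close>

lemma exp_half_mult_le: "y \<ge> 0 \<Longrightarrow> y * exp (y / 2) \<le> exp y - 1" for y :: real
proof -
  assume y: "y \<ge> 0"
  have "(exp 0 - 1) - 0 * exp (0 / 2) \<le> (exp y - 1) - y * exp (y / 2)"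
  proof (rule DERIV_nonneg_imp_nondecreasing[of 0 y "\<lambda>y. (exp y - 1) - y * exp (y / 2)", OF y])
    fix x :: real
    have "((\<lambda>y. (exp y - 1) - y * exp (y / 2)) has_real_derivative
        exp x - (exp (x / 2) + x / 2 * exp (x / 2))) (at x)"
      by (auto intro!: derivative_eq_intros)
    moreover have "exp (x / 2) * (1 + x / 2) \<le> exp (x / 2) * exp (x / 2)"
      by (intro mult_left_mono exp_ge_add_one_self) auto
    ultimately show "\<exists>z. ((\<lambda>y. (exp y - 1) - y * exp (y / 2)) has_real_derivative z) (at x) \<and> 0 \<le> z"
      by (intro exI conjI) (auto simp: mult_exp_exp algebra_simps)
  qed
  then show ?thesis by simp
qed

text \<open>The sign of the derivative reduces to y^2 exp y \<le> (exp y - 1)^2, the square of the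
  previous estimate. This supplies the upper bound for \<open>bose_quot\<close>.\<close>

lemma antimono_inverse_minus_bose:
  assumes "0 < s" "s \<le> r"
  shows "1 / (2 * pi * r) - bose r \<le> 1 / (2 * pi * s) - bose s"
proof (rule DERIV_nonpos_imp_nonincreasing[of s r "\<lambda>x. 1 / (2 * pi * x) - bose x", OF assms(2)])
  fix x assume "s \<le> x" "x \<le> r"
  then have x: "x > 0" using assms by simp
  define y where "y = 2 * pi * x"
  have y: "y > 0" using x by (simp add: y_def)
  have e: "exp y - 1 > 0" using y by simp
  have "((\<lambda>x. 1 / (2 * pi * x)) has_real_derivative 2 * pi * (- 1 / y\<^sup>2)) (at x)"
    unfolding y_def using x
    by (auto intro!: derivative_eq_intros simp: divide_simps power2_eq_square)
  moreover have "(bose has_real_derivative 2 * pi * (- exp y / (exp y - 1)\<^sup>2)) (at x)"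
    using e unfolding bose_def y_def
    by (auto intro!: derivative_eq_intros simp: power2_eq_square)
  ultimately have "((\<lambda>x. 1 / (2 * pi * x) - bose x) has_real_derivative
      2 * pi * (- 1 / y\<^sup>2) - 2 * pi * (- exp y / (exp y - 1)\<^sup>2)) (at x)"
    by (rule DERIV_diff)
  then have "((\<lambda>x. 1 / (2 * pi * x) - bose x) has_real_derivative
      2 * pi * (exp y / (exp y - 1)\<^sup>2 - 1 / y\<^sup>2)) (at x)"
    by (simp add: right_diff_distrib)
  moreover have "exp y / (exp y - 1)\<^sup>2 \<le> 1 / y\<^sup>2"
  proof -
    have "(y * exp (y / 2))\<^sup>2 \<le> (exp y - 1)\<^sup>2"
      using y by (intro power_mono exp_half_mult_le) auto
    moreover have "(exp (y / 2))\<^sup>2 = exp y" by (simp add: power2_eq_square mult_exp_exp)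
    ultimately have "y\<^sup>2 * exp y \<le> (exp y - 1)\<^sup>2"
      by (simp add: power_mult_distrib)
    then show ?thesis using e y by (simp add: divide_simps mult.commute)
  qed
  ultimately show "\<exists>z. ((\<lambda>x. 1 / (2 * pi * x) - bose x) has_real_derivative z) (at x) \<and> z \<le> 0"
    by (intro exI conjI) (auto simp: mult_nonneg_nonpos)
qed

text \<open>At the pole \<open>t = 1\<close> this is \<open>0\<close> by division by zero, so the bounds below hold there as well.\<close>

definition bose_quot :: "real \<Rightarrow> real \<Rightarrow> real" where
  "bose_quot a t = (t * bose (a * t) - bose a) / (1 - t\<^sup>2)"

lemma borel_measurable_bose_quot [measurable]: "bose_quot a \<in> borel_measurable borel"
  unfolding bose_quot_def by measurable

text \<open>Since 1 - t^2 = (1 - t) (1 + t), it suffices to bound \<open>n / (1 - t)\<close>. The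
  two monotonicity lemmas do so on each side of t = 1, where numerator and denominator change sign
  together.\<close>

lemma bose_quot_bounds:
  assumes "a > 0" "t > 0"
  shows "0 \<le> bose_quot a t" "bose_quot a t \<le> 1 / (2 * pi * a) * (1 / (1 + t))"
proof -
  define N where "N s = 1 / (2 * pi * s) - bose s" for s
  define n where "n = t * bose (a * t) - bose a"
  have N: "N a \<le> 1 / (2 * pi * a)" using bose_pos[OF assms(1)] by (simp add: N_def)
  \<comment> \<open>The poles cancel: \<open>t\<close> times 1 / (2 pi a t) is 1 / (2 pi a).\<close>
  have n_eq: "n = N a - t * N (a * t)" using assms by (simp add: N_def n_def algebra_simps)
  have an: "a * n = (a * t) * bose (a * t) - a * bose a" by (simp add: n_def algebra_simps)
  have q: "bose_quot a t = (n / (1 - t)) / (1 + t)"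
    by (simp add: bose_quot_def n_def power2_eq_square algebra_simps)
  have "0 \<le> n / (1 - t) \<and> n / (1 - t) \<le> 1 / (2 * pi * a)"
  proof (cases t "1 :: real" rule: linorder_cases)
    case less
    note True = less
    have "a * t \<le> a" using True assms by simp
    then have "0 \<le> a * n" unfolding an using antimono_mult_bose[of "a * t" a] assms by simp
    then have "0 \<le> n" using assms by (simp add: zero_le_mult_iff)
    have "N a \<le> N (a * t)"
      unfolding N_def using antimono_inverse_minus_bose[of "a * t" a] assms \<open>a * t \<le> a\<close> by simp
    then have "t * N a \<le> t * N (a * t)" using assms by simp
    then have "n \<le> (1 - t) * N a" unfolding n_eq by (simp add: algebra_simps)
    then have "n / (1 - t) \<le> N a" using True by (simp add: field_simps)
    then show ?thesis using \<open>0 \<le> n\<close> True N by auto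
  next
    case equal
    then show ?thesis using assms by simp
  next
    case greater
    note t = greater
    have "a \<le> a * t" using t assms by simp
    then have "a * n \<le> 0" unfolding an using antimono_mult_bose[of a "a * t"] assms by simp
    then have "n \<le> 0" using assms by (simp add: mult_le_0_iff)
    have "N (a * t) \<le> N a"
      unfolding N_def using antimono_inverse_minus_bose[of a "a * t"] assms \<open>a \<le> a * t\<close> by simp
    then have "t * N (a * t) \<le> t * N a" using assms by simp
    then have "(1 - t) * N a \<le> n" unfolding n_eq by (simp add: algebra_simps)
    then have "n / (1 - t) \<le> N a" using t by (simp add: field_simps)
    then show ?thesis using \<open>n \<le> 0\<close> t N by (auto simp: divide_nonpos_nonpos)
  qed
  then have "0 \<le> n / (1 - t)" "n / (1 - t) \<le> 1 / (2 * pi * a)" by auto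
  from divide_nonneg_nonneg[OF this(1), of "1 + t"] divide_right_mono[OF this(2), of "1 + t"]
  show "0 \<le> bose_quot a t" "bose_quot a t \<le> 1 / (2 * pi * a) * (1 / (1 + t))"
    unfolding q using assms by simp_all
qed

text \<open>In \<open>B_fun a - t * B_fun (a * t)\<close> the poles cancel and the constants leave
  (1 - t) / 2, while every pair of partial fractions contains the factor 1 - t^2.\<close>

lemma bose_quot_sums:
  assumes "a > 0" "t > 0" "t \<noteq> 1"
  shows "(\<lambda>k. a * (real (Suc k))\<^sup>2 / (((a * t)\<^sup>2 + (real (Suc k))\<^sup>2) * (a\<^sup>2 + (real (Suc k))\<^sup>2)) / pi) sums
    (1 / (2 * (1 + t)) - bose_quot a t)"
proof -
  have t: "1 - t\<^sup>2 \<noteq> 0" "1 + t \<noteq> 0" "1 - t \<noteq> 0" using assms by (simp_all add: power2_eq_1_iff)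
  have "(\<lambda>k. (a / (a\<^sup>2 + (real (Suc k))\<^sup>2) / pi - t * ((a * t) / ((a * t)\<^sup>2 + (real (Suc k))\<^sup>2) / pi)) / (1 - t\<^sup>2))
      sums ((B_fun a - t * B_fun (a * t)) / (1 - t\<^sup>2))"
    using assms by (intro sums_divide sums_diff sums_mult B_fun_sums) auto
  moreover have "(a / (a\<^sup>2 + k\<^sup>2) / pi - t * ((a * t) / ((a * t)\<^sup>2 + k\<^sup>2) / pi)) / (1 - t\<^sup>2) =
      a * k\<^sup>2 / (((a * t)\<^sup>2 + k\<^sup>2) * (a\<^sup>2 + k\<^sup>2)) / pi" for k
  proof -
    have "a\<^sup>2 + k\<^sup>2 \<noteq> 0" "(a * t)\<^sup>2 + k\<^sup>2 \<noteq> 0" using assms by (auto simp: add_nonneg_eq_0_iff)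
    then have "a / (a\<^sup>2 + k\<^sup>2) - t * ((a * t) / ((a * t)\<^sup>2 + k\<^sup>2)) =
        (1 - t\<^sup>2) * (a * k\<^sup>2 / (((a * t)\<^sup>2 + k\<^sup>2) * (a\<^sup>2 + k\<^sup>2)))"
      by (simp add: divide_simps) (simp add: algebra_simps power2_eq_square)
    then have "(a / (a\<^sup>2 + k\<^sup>2) - t * ((a * t) / ((a * t)\<^sup>2 + k\<^sup>2))) / (1 - t\<^sup>2) / pi =
        a * k\<^sup>2 / (((a * t)\<^sup>2 + k\<^sup>2) * (a\<^sup>2 + k\<^sup>2)) / pi"
      by (simp only: nonzero_mult_div_cancel_left[OF t(1)])
    then show ?thesis by (simp add: diff_divide_distrib mult.commute mult.left_commute)
  qed
  moreover have "(B_fun a - t * B_fun (a * t)) / (1 - t\<^sup>2) = 1 / (2 * (1 + t)) - bose_quot a t"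
  proof -
    have "B_fun a - t * B_fun (a * t) = (1 - t) / 2 - (t * bose (a * t) - bose a)"
      using assms by (simp add: B_fun_eq algebra_simps diff_divide_distrib)
    moreover have "(1 - t) / 2 / (1 - t\<^sup>2) = 1 / (2 * (1 + t))"
    proof -
      have "1 - t\<^sup>2 = (1 - t) * (1 + t)" by (simp add: power2_eq_square algebra_simps)
      then show ?thesis using t by simp
    qed
    ultimately show ?thesis by (simp add: bose_quot_def diff_divide_distrib)
  qed
  ultimately show ?thesis by simp
qed

section \<open>Sine integrals of the quotient \<open>bose_quot\<close>\<close>

text \<open>Both 1 and y bound |sin y|, hence so does sqrt y. The bound is integrable at 0 and grows
  only like the square root of the frequency, which later makes the series over n summable.\<close>

lemma abs_sin_divide_le_sqrt:
  fixes c t :: real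
  assumes "t > 0" "c \<ge> 0"
  shows "\<bar>sin (c * t) / t\<bar> \<le> sqrt c * (1 / sqrt t)"
proof -
  have "\<bar>sin (c * t)\<bar> \<le> sqrt (c * t)"
  proof (cases "c * t \<le> 1")
    case True
    have "\<bar>sin (c * t)\<bar> \<le> c * t" using abs_sin_x_le_abs_x[of "c * t"] assms by simp
    also have "c * t \<le> sqrt (c * t)"
      using True assms by (intro real_le_rsqrt) (simp add: power2_eq_square mult_left_le)
    finally show ?thesis .
  next
    case False
    then have "1 \<le> sqrt (c * t)" by simp
    then show ?thesis using abs_sin_le_one[of "c * t"] by linarith
  qed
  then have "\<bar>sin (c * t) / t\<bar> \<le> sqrt (c * t) / t"
    using assms by (simp add: abs_divide divide_right_mono)
  also have "\<dots> = sqrt c * (sqrt t / t)" by (simp add: real_sqrt_mult)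
  also have "sqrt t / t = 1 / sqrt t" using assms by (simp add: sqrt_divide_self_eq inverse_eq_divide)
  finally show ?thesis .
qed

lemma integrable_sin_mult:
  fixes h :: "real \<Rightarrow> real"
  assumes h: "h \<in> borel_measurable borel" and "c \<ge> 0" "C \<ge> 0"
    and bd: "\<And>t. t > 0 \<Longrightarrow> \<bar>h t\<bar> \<le> C * (1 / (1 + t))"
  shows "integrable pos_lborel (\<lambda>t. sin (c * t) / t * h t)"
proof -
  have I: "integrable pos_lborel (\<lambda>t. C * sqrt c * (1 / (sqrt t * (1 + t))))"
    by (intro integrable_mult_right integrable_inverse_sqrt_mult_add_one)
  have le: "AE t in pos_lborel. \<bar>sin (c * t) / t * h t\<bar> \<le> C * sqrt c * (1 / (sqrt t * (1 + t)))"
    using AE_space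
  proof eventually_elim
    case (elim t)
    then have t: "t > 0" by (simp add: space_restrict_space)
    have "\<bar>sin (c * t) / t\<bar> * \<bar>h t\<bar> \<le> (sqrt c * (1 / sqrt t)) * (C * (1 / (1 + t)))"
      using t elim assms by (intro mult_mono abs_sin_divide_le_sqrt bd) auto
    then show ?case by (simp add: abs_mult mult_ac)
  qed
  show "integrable pos_lborel (\<lambda>t. sin (c * t) / t * h t)"
  proof (rule Bochner_Integration.integrable_bound[OF I])
    show "(\<lambda>t. sin (c * t) / t * h t) \<in> borel_measurable pos_lborel"
      using h by (intro borel_measurable_pos_lborel) measurable
    show "AE t in pos_lborel. norm (sin (c * t) / t * h t) \<le> norm (C * sqrt c * (1 / (sqrt t * (1 + t))))"
      using le by eventually_elim (metis abs_ge_self order_trans real_norm_def)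
  qed
qed

text \<open>As a function of t the kernel is a constant times 1 / ((u / a)^2 + t^2); with frequency
  a b the exponent a b (u / a) becomes b u.\<close>

lemma integral_sin_kernel:
  fixes a b u :: real
  assumes "a > 0" "b > 0" "u > 0"
  shows "(LINT t|pos_lborel. sin (a * b * t) / t * (a * u\<^sup>2 / (((a * t)\<^sup>2 + u\<^sup>2) * (a\<^sup>2 + u\<^sup>2)) / pi)) =
    a / 2 * ((1 - exp (- (b * u))) / (a\<^sup>2 + u\<^sup>2))"
proof -
  have *: "a * u\<^sup>2 / (((a * t)\<^sup>2 + u\<^sup>2) * (a\<^sup>2 + u\<^sup>2)) / pi =
      (u\<^sup>2 / (a * pi * (a\<^sup>2 + u\<^sup>2))) * (1 / ((u / a)\<^sup>2 + t\<^sup>2))" for t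
  proof -
    have "(a * t)\<^sup>2 + u\<^sup>2 = a\<^sup>2 * ((u / a)\<^sup>2 + t\<^sup>2)"
      using assms by (simp add: field_simps power2_eq_square)
    then show ?thesis using assms by (simp add: power2_eq_square)
  qed
  have "(LINT t|pos_lborel. sin (a * b * t) / t * (a * u\<^sup>2 / (((a * t)\<^sup>2 + u\<^sup>2) * (a\<^sup>2 + u\<^sup>2)) / pi)) =
    (LINT t|pos_lborel. (u\<^sup>2 / (a * pi * (a\<^sup>2 + u\<^sup>2))) * (sin (a * b * t) / t * (1 / ((u / a)\<^sup>2 + t\<^sup>2))))"
    unfolding * by (simp only: mult_ac)
  also have "\<dots> = (u\<^sup>2 / (a * pi * (a\<^sup>2 + u\<^sup>2))) * (pi / 2 * (1 - exp (- (a * b * (u / a)))) / (u / a)\<^sup>2)"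
    using assms by (simp only: integral_mult_right_zero integral_sin_divide_quadratic(2) mult_pos_pos divide_pos_pos)
  also have "\<dots> = a / 2 * ((1 - exp (- (b * u))) / (a\<^sup>2 + u\<^sup>2))"
  proof -
    have "a * b * (u / a) = b * u" using assms by simp
    moreover have "(u / a)\<^sup>2 = u\<^sup>2 / a\<^sup>2" by (simp add: power_divide)
    ultimately show ?thesis using assms by (simp add: power2_eq_square mult.commute)
  qed
  finally show ?thesis .
qed

text \<open>Continuous counterpart of the expansion of \<open>bose_quot\<close>: 1 / (2 (1 + t)) is
  the integral over u of the kernel that is summed there, and Fubini lets the sine integral be taken
  first.\<close>

lemma integral_sin_divide_add_one:
  fixes a b :: real
  assumes "a > 0" "b > 0"
  shows "(LINT t|pos_lborel. sin (a * b * t) / t * (1 / (2 * (1 + t)))) =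
    a / 2 * (LINT u|pos_lborel. (1 - exp (- (b * u))) / (a\<^sup>2 + u\<^sup>2))"
proof -
  interpret pair_sigma_finite pos_lborel pos_lborel
    by (intro pair_sigma_finite.intro sigma_finite_pos_lborel)
  define k where "k t u = a * u\<^sup>2 / (((a * t)\<^sup>2 + u\<^sup>2) * (a\<^sup>2 + u\<^sup>2)) / pi" for t u :: real
  have k_nonneg: "0 \<le> k t u" for t u using assms by (simp add: k_def)
  have k_int: "integrable pos_lborel (k t)" "integral\<^sup>L pos_lborel (k t) = 1 / (2 * (1 + t))"
    if "t > 0" "t \<noteq> 1" for t
  proof -
    have k_eq: "k t = (\<lambda>u. (a / pi) * (u\<^sup>2 / (((a * t)\<^sup>2 + u\<^sup>2) * (a\<^sup>2 + u\<^sup>2))))"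
      by (simp add: k_def fun_eq_iff)
    have prem: "a > 0" "a * t > 0" "a \<noteq> a * t" using assms that by simp_all
    show "integrable pos_lborel (k t)"
      unfolding k_eq by (intro integrable_mult_right integral_product_of_quadratics prem)
    have "integral\<^sup>L pos_lborel (k t) = (a / pi) * (pi / (2 * (a + a * t)))"
      unfolding k_eq integral_mult_right_zero integral_product_of_quadratics(2)[OF prem] ..
    also have "a + a * t = a * (1 + t)" by (simp add: algebra_simps)
    finally show "integral\<^sup>L pos_lborel (k t) = 1 / (2 * (1 + t))"
      using assms by simp
  qed
  have [measurable]: "fst \<in> borel_measurable (pos_lborel \<Otimes>\<^sub>M pos_lborel)" "snd \<in> borel_measurable (pos_lborel \<Otimes>\<^sub>M pos_lborel)"
    by (auto intro!: measurable_compose[OF measurable_fst] measurable_compose[OF measurable_snd] borel_measurable_pos_lborel)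
  have meas: "(\<lambda>p. sin (a * b * fst p) / fst p * k (fst p) (snd p)) \<in> borel_measurable (pos_lborel \<Otimes>\<^sub>M pos_lborel)"
    unfolding k_def by measurable
  have inner: "AE t in pos_lborel. (LINT u|pos_lborel. sin (a * b * t) / t * k t u) = sin (a * b * t) / t * (1 / (2 * (1 + t)))"
    using AE_pos_lborel_neq[of 1] AE_space
    by eventually_elim (simp only: integral_mult_right_zero, simp add: k_int space_restrict_space)
  \<comment> \<open>The kernel is nonnegative, so the inner integral of the absolute value is again
    explicit; this gives the absolute integrability that Fubini requires.\<close>
  have inner_abs: "AE t in pos_lborel. (LINT u|pos_lborel. norm (sin (a * b * t) / t * k t u)) = norm (sin (a * b * t) / t * (1 / (2 * (1 + t))))"
    using AE_pos_lborel_neq[of 1] AE_space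
    by eventually_elim
      (simp only: norm_mult integral_mult_right_zero, simp add: k_nonneg k_int space_restrict_space)
  have I: "integrable pos_lborel (\<lambda>t. sin (a * b * t) / t * (1 / (2 * (1 + t))))"
    by (rule integrable_sin_mult[where C = "1 / 2"]) (use assms in auto)
  have int: "integrable (pos_lborel \<Otimes>\<^sub>M pos_lborel) (\<lambda>p. sin (a * b * fst p) / fst p * k (fst p) (snd p))"
  proof (rule Fubini_integrable[OF meas])
    show "integrable pos_lborel (\<lambda>x. LINT y|pos_lborel. norm (sin (a * b * fst (x, y)) / fst (x, y) * k (fst (x, y)) (snd (x, y))))"
      unfolding fst_conv snd_conv
    proof (rule Bochner_Integration.integrable_cong_AE_imp[OF integrable_norm[OF I]])
      show "(\<lambda>t. LINT u|pos_lborel. norm (sin (a * b * t) / t * k t u)) \<in> borel_measurable pos_lborel"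
        by (rule sigma_finite_measure.borel_measurable_lebesgue_integral[OF sigma_finite_pos_lborel]) (use measurable_compose[OF meas borel_measurable_norm] in \<open>simp add: split_beta'\<close>)
    qed (use inner_abs in \<open>auto elim: eventually_mono\<close>)
    show "AE x in pos_lborel. integrable pos_lborel (\<lambda>y. sin (a * b * fst (x, y)) / fst (x, y) * k (fst (x, y)) (snd (x, y)))"
      unfolding fst_conv snd_conv using AE_pos_lborel_neq[of 1] AE_space
      by eventually_elim (intro integrable_mult_right k_int, auto simp: space_restrict_space)
  qed
  have "(LINT t|pos_lborel. sin (a * b * t) / t * (1 / (2 * (1 + t)))) =
      (LINT t|pos_lborel. (LINT u|pos_lborel. sin (a * b * t) / t * k t u))"
    by (rule integral_cong_AE)
       (use inner I sigma_finite_measure.borel_measurable_lebesgue_integral[OF sigma_finite_pos_lborel, of "\<lambda>t u. sin (a * b * t) / t * k t u"] meas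
         in \<open>auto simp: split_beta' elim: eventually_mono\<close>)
  also have "\<dots> = (LINT u|pos_lborel. (LINT t|pos_lborel. sin (a * b * t) / t * k t u))"
    by (rule Fubini_integral[symmetric]) (use int in \<open>simp add: split_beta'\<close>)
  also have "\<dots> = (LINT u|pos_lborel. a / 2 * ((1 - exp (- (b * u))) / (a\<^sup>2 + u\<^sup>2)))"
    by (rule Bochner_Integration.integral_cong[OF refl])
       (unfold k_def, rule integral_sin_kernel, use assms in \<open>auto simp: space_restrict_space\<close>)
  finally show ?thesis by (simp only: integral_mult_right_zero)
qed

text \<open>\<open>bose_quot_sums\<close> is integrated term by term against the sine factor. The
  term 1 / (2 (1 + t)) contributes the integral over u, so the sine integral of
  \<open>bose_quot\<close> measures the gap between that integral and the sum over k.\<close>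

lemma integral_sin_mult_bose_quot:
  fixes a b :: real
  assumes "a > 0" "b > 0"
  shows "integrable pos_lborel (\<lambda>t. sin (a * b * t) / t * bose_quot a t)"
    "(\<lambda>k. (1 - exp (- (b * real (Suc k)))) / (a\<^sup>2 + (real (Suc k))\<^sup>2)) sums
      ((LINT u|pos_lborel. (1 - exp (- (b * u))) / (a\<^sup>2 + u\<^sup>2)) -
       2 / a * (LINT t|pos_lborel. sin (a * b * t) / t * bose_quot a t))"
proof -
  have Qbd: "\<bar>bose_quot a t\<bar> \<le> 1 / (2 * pi * a) * (1 / (1 + t))" if "t > 0" for t
    using bose_quot_bounds[of a t] that assms by simp
  note Q = integrable_sin_mult[of "bose_quot a" "a * b" "1 / (2 * pi * a)", OF _ _ _ Qbd]
  show intQ: "integrable pos_lborel (\<lambda>t. sin (a * b * t) / t * bose_quot a t)"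
    by (rule Q) (use assms in auto)
  define k where "k n t = a * (real (Suc n))\<^sup>2 / (((a * t)\<^sup>2 + (real (Suc n))\<^sup>2) * (a\<^sup>2 + (real (Suc n))\<^sup>2)) / pi"
    for n :: nat and t :: real
  define R where "R t = 1 / (2 * (1 + t)) - bose_quot a t" for t
  have k_nonneg: "0 \<le> k n t" for n t using assms by (simp add: k_def)
  have k_sums: "(\<lambda>n. k n t) sums R t" if "t > 0" "t \<noteq> 1" for t
    unfolding k_def R_def using bose_quot_sums[OF assms(1) that] .
  have I: "integrable pos_lborel (\<lambda>t. sin (a * b * t) / t * (1 / (2 * (1 + t))))"
    by (rule integrable_sin_mult[where C = "1 / 2"]) (use assms in auto)
  have R_eq: "sin (a * b * t) / t * R t = sin (a * b * t) / t * (1 / (2 * (1 + t))) - sin (a * b * t) / t * bose_quot a t" for t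
    by (simp only: R_def right_diff_distrib)
  have intR: "integrable pos_lborel (\<lambda>t. sin (a * b * t) / t * R t)"
    unfolding R_eq by (intro Bochner_Integration.integrable_diff I intQ)
  have "(\<lambda>n. LINT t|pos_lborel. sin (a * b * t) / t * k n t) sums (LINT t|pos_lborel. sin (a * b * t) / t * R t)"
  proof (rule sums_integral_dominated(2)[OF _ _ _ _ _ integrable_abs[OF intR], where g = "\<lambda>n t. \<bar>sin (a * b * t) / t * k n t\<bar>"])
    show "(\<lambda>t. sin (a * b * t) / t * k n t) \<in> borel_measurable pos_lborel" for n
      unfolding k_def by (intro borel_measurable_pos_lborel) measurable
    show "AE t in pos_lborel. (\<lambda>n. sin (a * b * t) / t * k n t) sums (sin (a * b * t) / t * R t)"
      using AE_pos_lborel_neq[of 1] AE_space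
      by eventually_elim (intro sums_mult k_sums, auto simp: space_restrict_space)
    \<comment> \<open>Nonnegative kernels make the absolute values sum exactly to the absolute value
      of the limit, so the series has an integrable majorant of its own.\<close>
    show "AE t in pos_lborel. (\<lambda>n. \<bar>sin (a * b * t) / t * k n t\<bar>) sums \<bar>sin (a * b * t) / t * R t\<bar>"
      using AE_pos_lborel_neq[of 1] AE_space
    proof eventually_elim
      case (elim t)
      then have s: "(\<lambda>n. k n t) sums R t" by (intro k_sums) (auto simp: space_restrict_space)
      then have "0 \<le> R t" using sums_le[OF _ sums_zero s] k_nonneg by simp
      then show ?case using sums_mult[OF s, of "\<bar>sin (a * b * t) / t\<bar>"] k_nonneg by (simp add: abs_mult)
    qed
  qed (use intR in auto)
  moreover have "(LINT t|pos_lborel. sin (a * b * t) / t * k n t) =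
      a / 2 * ((1 - exp (- (b * real (Suc n)))) / (a\<^sup>2 + (real (Suc n))\<^sup>2))" for n
    unfolding k_def by (rule integral_sin_kernel) (use assms in auto)
  moreover have "(LINT t|pos_lborel. sin (a * b * t) / t * R t) =
      a / 2 * (LINT u|pos_lborel. (1 - exp (- (b * u))) / (a\<^sup>2 + u\<^sup>2)) -
      (LINT t|pos_lborel. sin (a * b * t) / t * bose_quot a t)"
    unfolding R_eq integral_sin_divide_add_one[OF assms, symmetric]
    by (rule Bochner_Integration.integral_diff[OF I intQ])
  ultimately have "(\<lambda>n. a / 2 * ((1 - exp (- (b * real (Suc n)))) / (a\<^sup>2 + (real (Suc n))\<^sup>2))) sums
      (a / 2 * (LINT u|pos_lborel. (1 - exp (- (b * u))) / (a\<^sup>2 + u\<^sup>2)) -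
      (LINT t|pos_lborel. sin (a * b * t) / t * bose_quot a t))"
    by simp
  from sums_mult[OF this, of "2 / a"] assms
  show "(\<lambda>k. (1 - exp (- (b * real (Suc k)))) / (a\<^sup>2 + (real (Suc k))\<^sup>2)) sums
      ((LINT u|pos_lborel. (1 - exp (- (b * u))) / (a\<^sup>2 + u\<^sup>2)) -
       2 / a * (LINT t|pos_lborel. sin (a * b * t) / t * bose_quot a t))"
    by (simp add: right_diff_distrib)
qed

section \<open>Principal values\<close>

lemma pv_integral_eq: "has_pv_integral f I c A \<Longrightarrow> pv_integral f c A = I"
  unfolding pv_integral_def
  by (rule the_equality) (auto simp: has_pv_integral_def intro: tendsto_unique[OF trivial_limit_at_right_real])

lemma has_pv_integral_add:
  assumes "has_pv_integral f I c A" "has_pv_integral g J c A"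
  shows "has_pv_integral (\<lambda>t. f t + g t) (I + J) c A"
  unfolding has_pv_integral_def
proof (intro conjI allI impI)
  show "set_integrable lborel {t \<in> A. \<epsilon> < \<bar>t - c\<bar>} (\<lambda>t. f t + g t)" if "\<epsilon> > 0" for \<epsilon>
    using assms that by (intro set_integral_add) (auto simp: has_pv_integral_def)
  have "((\<lambda>\<epsilon>. (LINT t:{t \<in> A. \<epsilon> < \<bar>t - c\<bar>}|lborel. f t) + (LINT t:{t \<in> A. \<epsilon> < \<bar>t - c\<bar>}|lborel. g t))
      \<longlongrightarrow> I + J) (at_right 0)"
    using assms by (intro tendsto_add) (auto simp: has_pv_integral_def)
  moreover have "\<forall>\<^sub>F \<epsilon> in at_right 0. (LINT t:{t \<in> A. \<epsilon> < \<bar>t - c\<bar>}|lborel. f t) + (LINT t:{t \<in> A. \<epsilon> < \<bar>t - c\<bar>}|lborel. g t)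
      = (LINT t:{t \<in> A. \<epsilon> < \<bar>t - c\<bar>}|lborel. f t + g t)"
    using eventually_at_right_less[of 0]
    by eventually_elim (use assms in \<open>auto simp: has_pv_integral_def set_integral_add\<close>)
  ultimately show "((\<lambda>\<epsilon>. LINT t:{t \<in> A. \<epsilon> < \<bar>t - c\<bar>}|lborel. f t + g t) \<longlongrightarrow> I + J) (at_right 0)"
    by (rule Lim_transform_eventually)
qed

lemma has_pv_integral_cmult:
  assumes "has_pv_integral f I c A"
  shows "has_pv_integral (\<lambda>t. k * f t) (k * I) c A"
  using assms by (auto simp: has_pv_integral_def intro!: tendsto_mult)

lemma has_pv_integral_of_integrable:
  assumes F: "integrable pos_lborel F"
  shows "has_pv_integral F (integral\<^sup>L pos_lborel F) c {0<..}"
proof -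
  have meas: "{t \<in> {0<..}. \<epsilon> < \<bar>t - c\<bar>} \<in> sets lborel" for \<epsilon> by simp
  have int: "set_integrable lborel {0<..} F" using F by (simp add: integrable_pos_lborel_iff)
  \<comment> \<open>The cutoff \<epsilon> is written as 1 / T, so that dominated convergence at
    infinity applies.\<close>
  have "((\<lambda>T. LINT t|lborel. indicator {t \<in> {0<..}. inverse T < \<bar>t - c\<bar>} t *\<^sub>R F t) \<longlongrightarrow>
      (LINT t|lborel. indicator {0<..} t *\<^sub>R F t)) at_top"
  proof (rule integral_dominated_convergence_at_top[where w = "\<lambda>t. norm (indicator {0<..} t *\<^sub>R F t)"])
    have I: "set_integrable lborel {t \<in> {0<..}. inverse T < \<bar>t - c\<bar>} F" for T
      using int by (rule set_integrable_subset) (use meas in auto)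
    show "(\<lambda>t. indicator {t \<in> {0<..}. inverse T < \<bar>t - c\<bar>} t *\<^sub>R F t) \<in> borel_measurable lborel" for T
      using I[of T] unfolding set_integrable_def by (rule borel_measurable_integrable)
    show "AE t in lborel. ((\<lambda>T. indicator {t \<in> {0<..}. inverse T < \<bar>t - c\<bar>} t *\<^sub>R F t) \<longlongrightarrow>
        indicator {0<..} t *\<^sub>R F t) at_top"
      using AE_lborel_singleton[of c]
    proof eventually_elim
      case (elim t)
      then have "\<forall>\<^sub>F T in at_top. inverse T < \<bar>t - c\<bar>"
        by (intro order_tendstoD(2)[OF tendsto_inverse_0_at_top[OF filterlim_ident]]) auto
      then have "\<forall>\<^sub>F T in at_top. indicator {t \<in> {0<..}. inverse T < \<bar>t - c\<bar>} t *\<^sub>R F t = indicator {0<..} t *\<^sub>R F t"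
        by eventually_elim (auto split: split_indicator)
      then show ?case by (rule tendsto_eventually)
    qed
  qed (use int in \<open>auto simp: set_integrable_def intro!: always_eventually split: split_indicator\<close>)
  then show ?thesis
    using int meas unfolding has_pv_integral_def integral_pos_lborel set_lebesgue_integral_def filterlim_at_right_to_top
    by (auto intro: set_integrable_subset)
qed

text \<open>An explicit logarithmic primitive on both sides of the pole gives the truncated value.
  Because the limit is 0, subtracting from a numerator its value at t = 1 does not change the
  principal value.\<close>

lemma has_pv_integral_inverse_one_minus_square: "has_pv_integral (\<lambda>t. 1 / (1 - t\<^sup>2)) 0 1 {0<..}"
proof -
  have int: "set_integrable lborel {t \<in> {0<..}. \<epsilon> < \<bar>t - 1\<bar>} (\<lambda>t. 1 / (1 - t\<^sup>2))" if \<epsilon>: "\<epsilon> > 0" for \<epsilon> :: real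
  proof -
    have I: "set_integrable lborel {0<..} (\<lambda>t. (1 + 2 / \<epsilon>) * (1 / (1\<^sup>2 + t\<^sup>2)))"
      unfolding integrable_pos_lborel_iff[symmetric]
      by (intro integrable_mult_right integral_inverse_add_squares) simp
    show ?thesis
      unfolding set_integrable_def
    proof (rule Bochner_Integration.integrable_bound[OF I[unfolded set_integrable_def]])
      have "\<bar>1 / (1 - t\<^sup>2)\<bar> \<le> (1 + 2 / \<epsilon>) * (1 / (1\<^sup>2 + t\<^sup>2))" if t: "t > 0" "\<epsilon> < \<bar>t - 1\<bar>" for t
      proof -
        \<comment> \<open>Source of the constant: 1 + t is at most |t - 1| + 2, and 2 = (2 /
          \<epsilon>) \<epsilon> is at most (2 / \<epsilon>) |t - 1| outside the cutoff.\<close>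
        have "1 + t \<le> \<bar>t - 1\<bar> + 2 / \<epsilon> * \<epsilon>" using \<epsilon> t by simp
        also have "\<dots> \<le> \<bar>t - 1\<bar> + 2 / \<epsilon> * \<bar>t - 1\<bar>" using \<epsilon> t by (intro add_left_mono mult_left_mono) auto
        finally have "(1 + t) * (1 + t) \<le> ((1 + 2 / \<epsilon>) * \<bar>t - 1\<bar>) * (1 + t)"
          using t by (intro mult_right_mono) (auto simp: algebra_simps)
        also have "\<dots> = (1 + 2 / \<epsilon>) * \<bar>1 - t\<^sup>2\<bar>"
        proof -
          have "1 - t\<^sup>2 = - ((t - 1) * (1 + t))" by (simp add: power2_eq_square algebra_simps)
          then have "\<bar>1 - t\<^sup>2\<bar> = \<bar>t - 1\<bar> * (1 + t)" using t by (simp add: abs_mult)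
          then show ?thesis by simp
        qed
        finally have "1\<^sup>2 + t\<^sup>2 \<le> (1 + 2 / \<epsilon>) * \<bar>1 - t\<^sup>2\<bar>"
          using t by (simp add: power2_eq_square algebra_simps)
        moreover have "\<bar>1 - t\<^sup>2\<bar> > 0" using t \<epsilon> by (auto simp: power2_eq_1_iff)
        moreover have "1\<^sup>2 + t\<^sup>2 > 0" by (simp add: add_pos_nonneg)
        ultimately show ?thesis by (simp add: abs_divide field_simps)
      qed
      then show "AE t in lborel. norm (indicator {t \<in> {0<..}. \<epsilon> < \<bar>t - 1\<bar>} t *\<^sub>R (1 / (1 - t\<^sup>2)))
          \<le> norm (indicator {0<..} t *\<^sub>R ((1 + 2 / \<epsilon>) * (1 / (1\<^sup>2 + t\<^sup>2))))"
        using \<epsilon> by (intro AE_I2) (auto split: split_indicator simp: add_nonneg_nonneg)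
    qed measurable
  qed
  have val: "(LINT t:{t \<in> {0<..}. \<epsilon> < \<bar>t - 1\<bar>}|lborel. 1 / (1 - t\<^sup>2)) = ln ((2 - \<epsilon>) / (2 + \<epsilon>)) / 2"
    if \<epsilon>: "0 < \<epsilon>" "\<epsilon> < 1" for \<epsilon> :: real
  proof -
    have split: "{t \<in> {0<..}. \<epsilon> < \<bar>t - 1\<bar>} = {0<..<1 - \<epsilon>} \<union> {1 + \<epsilon><..}" using \<epsilon> by auto
    have "(LINT t:{t \<in> {0<..}. \<epsilon> < \<bar>t - 1\<bar>}|lborel. 1 / (1 - t\<^sup>2)) =
        (LINT t:{0<..<1 - \<epsilon>}|lborel. 1 / (1 - t\<^sup>2)) + (LINT t:{1 + \<epsilon><..}|lborel. 1 / (1 - t\<^sup>2))"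
      unfolding split
      by (intro set_integral_Un set_integrable_subset[OF int[OF \<epsilon>(1)]]) (use \<epsilon> in auto)
    also have "(LINT t:{0<..<1 - \<epsilon>}|lborel. 1 / (1 - t\<^sup>2)) = (ln (2 - \<epsilon>) - ln \<epsilon>) / 2"
    proof -
      have "(LBINT t=0..1 - \<epsilon>. 1 / (1 - t\<^sup>2)) =
          (ln (1 + (1 - \<epsilon>)) - ln (1 - (1 - \<epsilon>))) / 2 - (ln (1 + 0) - ln (1 - 0)) / 2"
        unfolding zero_ereal_def
      proof (rule interval_integral_FTC_finite)
        have nz: "1 - t\<^sup>2 \<noteq> 0" if "t \<in> {min 0 (1 - \<epsilon>)..max 0 (1 - \<epsilon>)}" for t
          using that \<epsilon> by (auto simp: power2_eq_1_iff min_def max_def split: if_splits)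
        then show "continuous_on {min 0 (1 - \<epsilon>)..max 0 (1 - \<epsilon>)} (\<lambda>t. 1 / (1 - t\<^sup>2))"
          by (intro continuous_intros) auto
        fix t assume t: "min 0 (1 - \<epsilon>) \<le> t" "t \<le> max 0 (1 - \<epsilon>)"
        then have "1 - t > 0" "1 + t > 0" using \<epsilon> by (auto simp: min_def max_def split: if_splits)
        then have "((\<lambda>t. (ln (1 + t) - ln (1 - t)) / 2) has_real_derivative (1 / (1 + t) + 1 / (1 - t)) / 2)
            (at t within {min 0 (1 - \<epsilon>)..max 0 (1 - \<epsilon>)})"
          by (auto intro!: derivative_eq_intros simp: divide_simps)
        also have "(1 / (1 + t) + 1 / (1 - t)) / 2 = 1 / (1 - t\<^sup>2)"
          using \<open>1 - t > 0\<close> \<open>1 + t > 0\<close> nz[of t] t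
          by (simp add: divide_simps) (simp add: algebra_simps power2_eq_square)
        finally show "((\<lambda>t. (ln (1 + t) - ln (1 - t)) / 2) has_vector_derivative 1 / (1 - t\<^sup>2))
            (at t within {min 0 (1 - \<epsilon>)..max 0 (1 - \<epsilon>)})"
          by (simp add: has_real_derivative_iff_has_vector_derivative)
      qed
      then show ?thesis using \<epsilon> by (simp add: interval_integral_Ioo zero_ereal_def)
    qed
    also have "(LINT t:{1 + \<epsilon><..}|lborel. 1 / (1 - t\<^sup>2)) = - ((ln (2 + \<epsilon>) - ln \<epsilon>) / 2)"
    proof -
      define L where "L t = (ln (t - 1) - ln (t + 1)) / 2" for t :: real
      \<comment> \<open>The sign is flipped so that the integrand is nonnegative to the right of 1,
        as the improper fundamental theorem used here demands.\<close>
      have "(LBINT t=ereal (1 + \<epsilon>)..\<infinity>. 1 / (t\<^sup>2 - 1)) = 0 - L (1 + \<epsilon>)"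
      proof (rule interval_integral_FTC_nonneg(2))
        have pos: "t - 1 > 0" "t + 1 > 0" "t\<^sup>2 - 1 > 0" if "ereal (1 + \<epsilon>) < ereal t" for t
          using that \<epsilon> by (auto simp: one_less_power)
        show "(L has_real_derivative 1 / (t\<^sup>2 - 1)) (at t)" if "ereal (1 + \<epsilon>) < ereal t" for t
        proof -
          have "(L has_real_derivative (1 / (t - 1) - 1 / (t + 1)) / 2) (at t)"
            unfolding L_def using pos[OF that] by (auto intro!: derivative_eq_intros)
          also have "(1 / (t - 1) - 1 / (t + 1)) / 2 = 1 / (t\<^sup>2 - 1)"
          proof -
            have "t - 1 \<noteq> 0" "t + 1 \<noteq> 0" "t\<^sup>2 - 1 = (t - 1) * (t + 1)"
              using pos[OF that] by (auto simp: power2_eq_square algebra_simps)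
            then show ?thesis by (simp add: divide_simps)
          qed
          finally show ?thesis .
        qed
        show "isCont (\<lambda>t. 1 / (t\<^sup>2 - 1)) t" if "ereal (1 + \<epsilon>) < ereal t" for t
          using pos(3)[OF that] by (intro continuous_intros) linarith
        show "AE t in lborel. ereal (1 + \<epsilon>) < ereal t \<longrightarrow> ereal t < \<infinity> \<longrightarrow> 0 \<le> 1 / (t\<^sup>2 - 1)"
          using pos by (intro AE_I2) (auto intro: less_imp_le)
        have "(L \<longlongrightarrow> L (1 + \<epsilon>)) (at_right (1 + \<epsilon>))"
          unfolding L_def using \<epsilon> by (intro tendsto_intros) auto
        then show "((L \<circ> real_of_ereal) \<longlongrightarrow> L (1 + \<epsilon>)) (at_right (ereal (1 + \<epsilon>)))"
          by (simp add: ereal_tendsto_simps)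
        have "(L \<longlongrightarrow> 0) at_top" unfolding L_def by real_asymp
        then show "((L \<circ> real_of_ereal) \<longlongrightarrow> 0) (at_left \<infinity>)"
          by (simp add: ereal_tendsto_simps)
      qed auto
      moreover have "(LINT t:{1 + \<epsilon><..}|lborel. 1 / (1 - t\<^sup>2)) = - (LINT t:{1 + \<epsilon><..}|lborel. 1 / (t\<^sup>2 - 1))"
      proof -
        have "1 / (1 - t\<^sup>2) = - (1 / (t\<^sup>2 - 1))" for t :: real
          by (metis minus_diff_eq minus_divide_right)
        then show ?thesis by (simp add: set_lebesgue_integral_def)
      qed
      ultimately show ?thesis by (simp add: interval_integral_to_infinity_eq L_def algebra_simps diff_divide_distrib)
    qed
    \<comment> \<open>The divergent terms \<open>ln \<epsilon>\<close> from the two sides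
      cancel.\<close>
    also have "(ln (2 - \<epsilon>) - ln \<epsilon>) / 2 + - ((ln (2 + \<epsilon>) - ln \<epsilon>) / 2) = ln ((2 - \<epsilon>) / (2 + \<epsilon>)) / 2"
      using \<epsilon> by (subst ln_div) (auto simp: field_simps)
    finally show ?thesis .
  qed
  have "((\<lambda>\<epsilon>. ln ((2 - \<epsilon>) / (2 + \<epsilon>)) / 2) \<longlongrightarrow> ln ((2 - 0) / (2 + 0)) / 2) (at_right (0::real))"
    by (intro tendsto_intros) auto
  moreover have "\<forall>\<^sub>F \<epsilon> in at_right (0::real). ln ((2 - \<epsilon>) / (2 + \<epsilon>)) / 2 =
      (LINT t:{t \<in> {0<..}. \<epsilon> < \<bar>t - 1\<bar>}|lborel. 1 / (1 - t\<^sup>2))"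
    using eventually_at_right[of 0 "1::real"] val by (auto intro!: exI[of _ 1])
  ultimately have "((\<lambda>\<epsilon>. LINT t:{t \<in> {0<..}. \<epsilon> < \<bar>t - 1\<bar>}|lborel. 1 / (1 - t\<^sup>2)) \<longlongrightarrow> ln ((2 - 0) / (2 + 0 :: real)) / 2) (at_right 0)"
    by (rule Lim_transform_eventually)
  then show ?thesis
    unfolding has_pv_integral_def using int by simp
qed

section \<open>The logarithm of the q-Pochhammer symbol\<close>

lemma neg_ln_one_minus_sums:
  fixes y :: real
  assumes "0 \<le> y" "y < 1"
  shows "(\<lambda>n. y ^ Suc n / real (Suc n)) sums (- ln (1 - y))"
proof -
  have "(\<lambda>n. - ((- (- y)) ^ n) / real n) sums ln (1 + (- y))"
    by (rule ln_series') (use assms in simp)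
  then have "(\<lambda>n. - (- (y ^ n) / real n)) sums (- ln (1 - y))"
    by (intro sums_minus) simp
  \<comment> \<open>The term with index 0 is a division by zero, hence 0, so the shift leaves the
    sum unchanged.\<close>
  then show ?thesis
    by (subst sums_Suc_iff) simp
qed

text \<open>After division by \<open>s\<close> each partial fraction is at most 1 / (pi n^2), and
  the sum of inverse squares gives pi / 6. This controls the factor 1 / t in the integral of the
  theorem.\<close>

lemma B_fun_divide_bounds:
  assumes "s > 0"
  shows "0 \<le> B_fun s / s" "B_fun s / s \<le> pi / 6"
proof -
  have S: "(\<lambda>n. 1 / (s\<^sup>2 + (real (Suc n))\<^sup>2) / pi) sums (B_fun s / s)"
    using sums_divide[OF B_fun_sums[OF assms], of s] assms by simp
  show "0 \<le> B_fun s / s"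
    by (rule sums_le[OF _ sums_zero S]) simp
  have "(\<lambda>n. 1 / (real (Suc n))\<^sup>2 / pi) sums (pi\<^sup>2 / 6 / pi)"
    using sums_divide[OF inverse_squares_sums, of pi] by (simp add: add.commute)
  from sums_le[OF _ S this] show "B_fun s / s \<le> pi / 6"
    by (simp add: power2_eq_square divide_right_mono frac_le add_pos_nonneg)
qed

text \<open>The logarithms of the factors form a double series of nonnegative terms up to sign.
  Summing first over the factors gives geometric series, and the definition of \<open>B_fun\<close>
  splits each 1 / (1 - q^m) into the dilogarithm, logarithm and \<open>B_fun\<close> parts.\<close>

lemma ln_qpoch_inf_sums:
  fixes q x \<alpha> :: real
  assumes \<alpha>: "\<alpha> > 0" "q = exp (- (2 * pi * \<alpha>))" and x: "0 < x" "x < 1"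
  shows "(\<lambda>k. B_fun (\<alpha> * real (Suc k)) * x ^ Suc k / real (Suc k)) sums
    (dilog x / ln q + ln (1 - x) / 2 - ln (qpoch_inf x q))"
proof -
  have q: "0 < q" "q < 1" using \<alpha> by simp_all
  have lnq: "ln q = - (2 * pi * \<alpha>)" using \<alpha> by simp
  let ?Y = "\<lambda>k. B_fun (\<alpha> * real (Suc k)) * x ^ Suc k / real (Suc k)"
  have "summable ?Y"
  proof (rule summable_comparison_test')
    show "summable (\<lambda>k. \<alpha> * (pi / 6) * x ^ Suc k)"
      using x by (intro summable_mult) (simp add: summable_geometric)
    fix k :: nat
    have "0 \<le> B_fun (\<alpha> * real (Suc k)) / (\<alpha> * real (Suc k))" "B_fun (\<alpha> * real (Suc k)) / (\<alpha> * real (Suc k)) \<le> pi / 6"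
      using B_fun_divide_bounds[of "\<alpha> * real (Suc k)"] \<alpha> by auto
    moreover have "?Y k = \<alpha> * (B_fun (\<alpha> * real (Suc k)) / (\<alpha> * real (Suc k))) * x ^ Suc k"
      using \<alpha> by simp
    ultimately show "norm (?Y k) \<le> \<alpha> * (pi / 6) * x ^ Suc k"
      using \<alpha> x by (auto simp only: real_norm_def abs_mult abs_of_nonneg zero_le_power less_imp_le
        intro!: mult_right_mono mult_left_mono)
  qed
  then have Y: "?Y sums suminf ?Y" by (rule summable_sums)
  have dl: "(\<lambda>k. x ^ Suc k / (real (Suc k))\<^sup>2) sums dilog x"
    unfolding dilog_def
  proof (rule summable_sums, rule summable_comparison_test')
    show "summable (\<lambda>k. x ^ Suc k)" using x by (simp add: summable_geometric)
    fix k :: nat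
    have "x ^ Suc k / (real (Suc k))\<^sup>2 \<le> x ^ Suc k / 1"
      using x by (intro divide_left_mono) (auto simp: one_le_power)
    then show "norm (x ^ Suc k / (real (Suc k))\<^sup>2) \<le> x ^ Suc k" using x by simp
  qed
  define F where "F m = x ^ Suc m / real (Suc m) * (1 / (1 - q ^ Suc m))" for m
  have F_eq: "F m = x ^ Suc m / (real (Suc m))\<^sup>2 * (- 1 / ln q) + x ^ Suc m / real (Suc m) * (1 / 2) + ?Y m" for m
  proof -
    \<comment> \<open>Here \<open>E\<close> is the inverse of \<open>q ^ Suc m\<close>, so 1 / (1 -
      1 / E) = 1 + 1 / (E - 1), and 1 / (E - 1) is read off from \<open>B_fun\<close>.\<close>
    define E where "E = exp (2 * pi * (\<alpha> * real (Suc m)))"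
    have E: "E > 1" using \<alpha> by (simp add: E_def)
    have "q ^ Suc m = exp (- (2 * pi * (\<alpha> * real (Suc m))))"
      unfolding \<alpha>(2) exp_of_nat_mult[symmetric] by (simp add: algebra_simps)
    then have "q ^ Suc m = 1 / E" by (simp add: E_def exp_minus inverse_eq_divide)
    moreover have "1 / (1 - 1 / E) = 1 + 1 / (E - 1)" using E by (simp add: divide_simps)
    ultimately have "1 / (1 - q ^ Suc m) = 1 + 1 / (E - 1)" by (simp only:)
    also have "\<dots> = 1 / (2 * pi * (\<alpha> * real (Suc m))) + 1 / 2 + B_fun (\<alpha> * real (Suc m))"
      by (simp add: B_fun_def E_def)
    finally have "F m = x ^ Suc m / real (Suc m) * (1 / (2 * pi * (\<alpha> * real (Suc m)))) +
        x ^ Suc m / real (Suc m) * (1 / 2) + x ^ Suc m / real (Suc m) * B_fun (\<alpha> * real (Suc m))"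
      unfolding F_def by (simp only: distrib_left)
    then show ?thesis unfolding lnq using \<alpha> by (simp add: power2_eq_square mult_ac)
  qed
  have Fs: "F sums (dilog x * (- 1 / ln q) + - ln (1 - x) * (1 / 2) + suminf ?Y)"
    unfolding F_eq by (intro sums_add sums_mult2 dl neg_ln_one_minus_sums Y) (use x in auto)
  have row: "(\<lambda>k. (x * q ^ k) ^ Suc m / real (Suc m)) sums F m" for m
  proof -
    have "(\<lambda>k. (q ^ Suc m) ^ k) sums (1 / (1 - q ^ Suc m))"
      using q power_Suc_less_one[of q m] by (intro geometric_sums) auto
    from sums_mult[OF this, of "x ^ Suc m / real (Suc m)"]
    have "(\<lambda>k. x ^ Suc m / real (Suc m) * (q ^ Suc m) ^ k) sums F m" by (simp only: F_def)
    moreover have "x ^ Suc m / real (Suc m) * (q ^ Suc m) ^ k = (x * q ^ k) ^ Suc m / real (Suc m)" for k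
      by (simp only: power_mult_distrib power_mult[symmetric] mult.commute times_divide_eq_right)
    ultimately show ?thesis by (simp only:)
  qed
  have lt: "0 \<le> x * q ^ k" "x * q ^ k < 1" for k
  proof -
    have "q ^ k \<le> 1" using q by (simp add: power_le_one)
    then have "x * q ^ k \<le> x * 1" using x by (intro mult_left_mono) auto
    then have "x * q ^ k < 1" using x by linarith
    then show "0 \<le> x * q ^ k" "x * q ^ k < 1" using x q by auto
  qed
  have S: "(\<lambda>k. - ln (1 - x * q ^ k)) sums (dilog x * (- 1 / ln q) + - ln (1 - x) * (1 / 2) + suminf ?Y)"
  proof (rule sums_swap_nonneg[OF _ row Fs])
    show "0 \<le> (x * q ^ k) ^ Suc m / real (Suc m)" for k m
      using lt(1)[of k] by (intro divide_nonneg_nonneg zero_le_power) auto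
    show "(\<lambda>m. (x * q ^ k) ^ Suc m / real (Suc m)) sums - ln (1 - x * q ^ k)" for k
      by (rule neg_ln_one_minus_sums[OF lt])
  qed
  from sums_minus[OF this] have S': "(\<lambda>k. ln (1 - x * q ^ k)) sums - (dilog x * (- 1 / ln q) + - ln (1 - x) * (1 / 2) + suminf ?Y)"
    by simp
  \<comment> \<open>Every factor is positive by \<open>lt\<close>, so the product is the exponential
    of the convergent sum of logarithms.\<close>
  have "qpoch_inf x q = (\<Prod>k. exp (ln (1 - x * q ^ k)))"
    unfolding qpoch_inf_def using lt by simp
  also have "\<dots> = exp (\<Sum>k. ln (1 - x * q ^ k))"
    using S' by (intro prodinf_exp) (auto simp: sums_iff)
  finally have "ln (qpoch_inf x q) = - (dilog x * (- 1 / ln q) + - ln (1 - x) * (1 / 2) + suminf ?Y)"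
    using S' by (simp add: sums_iff)
  then have "suminf ?Y = dilog x / ln q + ln (1 - x) / 2 - ln (qpoch_inf x q)" by simp
  with Y show ?thesis by simp
qed

section \<open>The correction term M\<close>

lemma bose_le_square:
  assumes "s > 0"
  shows "bose s \<le> 1 / s\<^sup>2"
proof -
  have "1 \<le> pi\<^sup>2" using pi_ge_two by (simp add: one_le_power)
  then have "1 * s\<^sup>2 \<le> 2 * pi\<^sup>2 * s\<^sup>2" by (intro mult_right_mono) auto
  also have "\<dots> \<le> exp (2 * pi * s) - 1"
  proof -
    have "2 * pi\<^sup>2 * s\<^sup>2 = (2 * pi * s)\<^sup>2 / 2" by (simp add: power_mult_distrib)
    moreover have "0 < 2 * pi * s" using assms by simp
    ultimately show ?thesis using exp_lower_Taylor_quadratic[of "2 * pi * s"] by linarith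
  qed
  finally show ?thesis
    unfolding bose_def using assms by (intro divide_left_mono) auto
qed

lemma summable_inverse_squares: "summable (\<lambda>n. 1 / (real (Suc n))\<^sup>2)"
  using inverse_squares_sums by (simp add: sums_iff add.commute)

context
  fixes \<alpha> \<nu> :: real
  assumes \<alpha>: "\<alpha> > 0" and \<nu>: "\<nu> > 0"
begin

text \<open>The index is shifted by one. \<open>node n\<close> plays the role of \<open>a\<close> in
  the integrals above, and \<open>freq n\<close> that of \<open>a * b\<close> with
  \<open>b = 2 * pi * \<nu> * \<alpha>\<close>.\<close>

definition "freq n = 2 * pi * \<nu> * real (Suc n)"
definition "node n = real (Suc n) / \<alpha>"
definition "summand n t = sin (freq n * t) * bose (node n * t) / real (Suc n)"

lemma freq_pos: "freq n > 0" and node_pos: "node n > 0"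
  using \<alpha> \<nu> by (simp_all add: freq_def node_def)

lemma freq_eq: "freq n = node n * (2 * pi * \<nu> * \<alpha>)"
  using \<alpha> by (simp add: freq_def node_def)

lemma M_integrand_eq: "M_integrand \<alpha> \<nu> t = (\<Sum>n. summand n t) / (1 - t\<^sup>2)"
proof -
  have "sin (2 * real (Suc n) * \<nu> * pi * t) / (real (Suc n) * (exp (2 * real (Suc n) * pi * t / \<alpha>) - 1)) = summand n t" for n
  proof -
    have "2 * real (Suc n) * \<nu> * pi * t = freq n * t" by (simp only: freq_def mult_ac)
    moreover have "2 * real (Suc n) * pi * t / \<alpha> = 2 * pi * (node n * t)" by (simp add: node_def)
    ultimately show ?thesis by (simp only: summand_def bose_def) simp
  qed
  then show ?thesis by (simp only: M_integrand_def)
qed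

lemma summable_bose_node:
  assumes "t > 0"
  shows "summable (\<lambda>n. bose (node n * t) / real (Suc n))"
proof (rule summable_comparison_test')
  show "summable (\<lambda>n. (\<alpha> / t)\<^sup>2 * (1 / (real (Suc n))\<^sup>2))"
    by (intro summable_mult summable_inverse_squares)
  fix n :: nat
  have pos: "node n * t > 0" using assms node_pos by simp
  have "bose (node n * t) / real (Suc n) \<le> bose (node n * t) / 1"
    using bose_pos[OF pos] by (intro divide_left_mono) auto
  also have "\<dots> \<le> 1 / (node n * t)\<^sup>2" using bose_le_square[OF pos] by simp
  also have "\<dots> = (\<alpha> / t)\<^sup>2 * (1 / (real (Suc n))\<^sup>2)"
    using \<alpha> assms by (simp add: node_def power_divide power_mult_distrib)
  finally show "norm (bose (node n * t) / real (Suc n)) \<le> (\<alpha> / t)\<^sup>2 * (1 / (real (Suc n))\<^sup>2)"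
    using bose_pos[OF pos] by simp
qed

lemma summable_summand:
  assumes "t > 0"
  shows "summable (\<lambda>n. summand n t)"
proof (rule summable_comparison_test'[OF summable_bose_node[OF assms]])
  fix n :: nat
  have pos: "node n * t > 0" using assms node_pos by simp
  have "\<bar>sin (freq n * t)\<bar> * bose (node n * t) \<le> 1 * bose (node n * t)"
    using bose_pos[OF pos] by (intro mult_right_mono) auto
  then show "norm (summand n t) \<le> bose (node n * t) / real (Suc n)"
    using bose_pos[OF pos] by (simp add: summand_def abs_mult divide_right_mono)
qed

definition "cosine_series = (\<Sum>n. cos (freq n) * bose (node n) / real (Suc n))"

lemma cosine_series_sums: "(\<lambda>n. cos (freq n) * bose (node n) / real (Suc n)) sums cosine_series"
  unfolding cosine_series_def
proof (rule summable_sums, rule summable_comparison_test'[OF summable_bose_node[of 1]])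
  fix n :: nat
  have "\<bar>cos (freq n)\<bar> * bose (node n) \<le> 1 * bose (node n)"
    using bose_pos[OF node_pos[of n]] by (intro mult_right_mono) auto
  then show "norm (cos (freq n) * bose (node n) / real (Suc n)) \<le> bose (node n * 1) / real (Suc n)"
    using bose_pos[OF node_pos[of n]] by (simp add: abs_mult divide_right_mono)
qed simp

lemma M_fun_eq: "M_fun \<alpha> \<nu> = - cosine_series - 2 / pi * pv_integral (M_integrand \<alpha> \<nu>) 1 {0<..}"
proof -
  have "cos (2 * real (Suc n) * pi * \<nu>) / (real (Suc n) * (exp (2 * real (Suc n) * pi / \<alpha>) - 1)) =
      cos (freq n) * bose (node n) / real (Suc n)" for n
  proof -
    have "2 * real (Suc n) * pi * \<nu> = freq n" by (simp only: freq_def mult_ac)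
    moreover have "2 * real (Suc n) * pi / \<alpha> = 2 * pi * node n" by (simp add: node_def)
    ultimately show ?thesis by (simp only: bose_def) simp
  qed
  then show ?thesis by (simp only: M_fun_def cosine_series_def)
qed

section \<open>The regularised integrand and its termwise integration\<close>

text \<open>Subtracting the value at t = 1 removes the singularity; the subtracted constant meets 1
  / (1 - t^2), whose principal value is 0.\<close>

definition "diff_quot n t = (summand n t - summand n 1) / (1 - t\<^sup>2)"

text \<open>Product rule for differences, applied to the factors sin (freq t) / t and t
  \<open>bose\<close> (node t): the first difference gives the sine quotient, the second gives
  \<open>bose_quot\<close>.\<close>

lemma diff_quot_eq:
  assumes "t > 0"
  shows "diff_quot n t = (bose (node n) * ((sin (freq n * t) / t - sin (freq n)) / (1 - t\<^sup>2)) +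
    sin (freq n * t) / t * bose_quot (node n) t) / real (Suc n)"
proof -
  have "bose (node n) * (sin (freq n * t) / t - sin (freq n)) + sin (freq n * t) / t * (t * bose (node n * t) - bose (node n))
      = sin (freq n * t) * bose (node n * t) - sin (freq n) * bose (node n)"
    using assms by (simp add: right_diff_distrib)
  then have "(bose (node n) * (sin (freq n * t) / t - sin (freq n)) + sin (freq n * t) / t * (t * bose (node n * t) - bose (node n))) / real (Suc n)
      = summand n t - summand n 1"
    by (simp only: summand_def diff_divide_distrib mult_1_right)
  then have "diff_quot n t = (bose (node n) * (sin (freq n * t) / t - sin (freq n)) +
      sin (freq n * t) / t * (t * bose (node n * t) - bose (node n))) / real (Suc n) / (1 - t\<^sup>2)"
    by (simp only: diff_quot_def)
  also have "\<dots> = (bose (node n) * (sin (freq n * t) / t - sin (freq n)) +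
      sin (freq n * t) / t * (t * bose (node n * t) - bose (node n))) / (1 - t\<^sup>2) / real (Suc n)"
    by (simp only: divide_divide_eq_left mult.commute)
  finally show ?thesis
    by (simp only: bose_quot_def add_divide_distrib times_divide_eq_right)
qed

lemma integral_diff_quot:
  "integrable pos_lborel (diff_quot n)"
  "integral\<^sup>L pos_lborel (diff_quot n) =
    (bose (node n) * (pi / 2 * (1 - cos (freq n))) +
     (LINT t|pos_lborel. sin (freq n * t) / t * bose_quot (node n) t)) / real (Suc n)"
proof -
  note D = integral_sin_quotient[OF freq_pos[of n]]
  have Q: "integrable pos_lborel (\<lambda>t. sin (freq n * t) / t * bose_quot (node n) t)"
    unfolding freq_eq by (rule integral_sin_mult_bose_quot) (use node_pos \<alpha> \<nu> in auto)
  have cong: "t \<in> space pos_lborel \<Longrightarrow> diff_quot n t = (bose (node n) * ((sin (freq n * t) / t - sin (freq n)) / (1 - t\<^sup>2)) +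
    sin (freq n * t) / t * bose_quot (node n) t) / real (Suc n)" for t
    by (rule diff_quot_eq) (simp add: space_restrict_space)
  show "integrable pos_lborel (diff_quot n)"
    by (subst Bochner_Integration.integrable_cong[OF refl cong], assumption)
       (intro integrable_divide Bochner_Integration.integrable_add integrable_mult_right D Q)
  have "integral\<^sup>L pos_lborel (diff_quot n) =
      (LINT t|pos_lborel. (bose (node n) * ((sin (freq n * t) / t - sin (freq n)) / (1 - t\<^sup>2)) +
        sin (freq n * t) / t * bose_quot (node n) t) / real (Suc n))"
    by (rule Bochner_Integration.integral_cong[OF refl cong])
  also have "\<dots> = ((LINT t|pos_lborel. bose (node n) * ((sin (freq n * t) / t - sin (freq n)) / (1 - t\<^sup>2))) +
      (LINT t|pos_lborel. sin (freq n * t) / t * bose_quot (node n) t)) / real (Suc n)"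
    unfolding integral_divide_zero
    by (subst Bochner_Integration.integral_add[OF integrable_mult_right[OF D(1)] Q]) simp
  finally show "integral\<^sup>L pos_lborel (diff_quot n) =
    (bose (node n) * (pi / 2 * (1 - cos (freq n))) +
     (LINT t|pos_lborel. sin (freq n * t) / t * bose_quot (node n) t)) / real (Suc n)"
    by (simp only: integral_mult_right_zero D(2))
qed

text \<open>The square root of the frequency contributes n^(1/2), while 1 / \<open>node n\<close>
  and the outer 1 / n contribute n^(-2).\<close>

definition "weight n = real (Suc n) powr (- 3 / 2)"

lemma summable_weight: "summable weight"
  unfolding weight_def[abs_def]
  using summable_real_powr_iff[of "- 3 / 2"] by (subst summable_Suc_iff) simp

lemma inverse_square_le_weight: "1 / (real (Suc n))\<^sup>2 \<le> weight n"
proof -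
  have "real (Suc n) powr (- 2) \<le> real (Suc n) powr (- 3 / 2)" by (intro powr_mono) auto
  then show ?thesis by (simp add: weight_def powr_minus powr_numeral inverse_eq_divide)
qed

lemma sqrt_divide_square_eq_weight: "sqrt (real (Suc n)) / (real (Suc n))\<^sup>2 = weight n"
proof -
  have "real (Suc n) powr (1 / 2) / real (Suc n) powr 2 = real (Suc n) powr (1 / 2 - 2)"
    by (rule powr_diff[symmetric])
  then show ?thesis by (simp add: weight_def powr_half_sqrt powr_numeral)
qed

text \<open>The first summand belongs to the sine quotient, the second to the
  \<open>bose_quot\<close> part of \<open>diff_quot\<close>.\<close>

definition "majorant t = \<alpha>\<^sup>2 * (10 * (1 + 2 * pi * \<nu>)) * (1 / (1\<^sup>2 + t\<^sup>2)) +
  \<alpha> / (2 * pi) * sqrt (2 * pi * \<nu>) * (1 / (sqrt t * (1 + t)))"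

lemma abs_diff_quot_le:
  assumes "t > 0"
  shows "\<bar>diff_quot n t\<bar> \<le> weight n * majorant t"
proof -
  let ?N = "real (Suc n)"
  have b: "0 < bose (node n)" "bose (node n) \<le> \<alpha>\<^sup>2 * (1 / ?N\<^sup>2)"
    using bose_pos[OF node_pos[of n]] bose_le_square[OF node_pos[of n]] by (auto simp: node_def power_divide)
  \<comment> \<open>The outer factor 1 / n absorbs the linear growth of the frequency, so the decay
    of \<open>bose\<close> is left to supply the weight.\<close>
  have f: "(1 + freq n) / ?N \<le> 1 + 2 * pi * \<nu>"
    using \<nu> by (simp add: freq_def field_simps)
  have "\<bar>bose (node n) * ((sin (freq n * t) / t - sin (freq n)) / (1 - t\<^sup>2))\<bar> / ?N \<le>
      bose (node n) * (10 * (1 + freq n) * (1 / (1\<^sup>2 + t\<^sup>2))) / ?N"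
    unfolding abs_mult using b sin_quotient_bound[OF freq_pos[of n] assms]
    by (intro divide_right_mono mult_mono) auto
  also have "\<dots> = bose (node n) * (((1 + freq n) / ?N) * (10 * (1 / (1\<^sup>2 + t\<^sup>2))))"
    by (simp add: mult_ac)
  also have "\<dots> \<le> (\<alpha>\<^sup>2 * weight n) * ((1 + 2 * pi * \<nu>) * (10 * (1 / (1\<^sup>2 + t\<^sup>2))))"
  proof (intro mult_mono f)
    show "bose (node n) \<le> \<alpha>\<^sup>2 * weight n"
      using b(2) mult_left_mono[OF inverse_square_le_weight[of n], of "\<alpha>\<^sup>2"] by simp
  qed (use \<nu> freq_pos[of n] in \<open>auto simp: weight_def\<close>)
  finally have 1: "\<bar>bose (node n) * ((sin (freq n * t) / t - sin (freq n)) / (1 - t\<^sup>2))\<bar> / ?N \<le>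
      weight n * (\<alpha>\<^sup>2 * (10 * (1 + 2 * pi * \<nu>)) * (1 / (1\<^sup>2 + t\<^sup>2)))" by (simp only: mult_ac)
  have "\<bar>sin (freq n * t) / t * bose_quot (node n) t\<bar> / ?N \<le>
      (sqrt (freq n) * (1 / sqrt t)) * (1 / (2 * pi * node n) * (1 / (1 + t))) / ?N"
    unfolding abs_mult using abs_sin_divide_le_sqrt[OF assms, of "freq n"] freq_pos[of n]
      bose_quot_bounds[OF node_pos[of n] assms] assms
    by (intro divide_right_mono mult_mono) auto
  also have "\<dots> = (sqrt ?N / ?N\<^sup>2) * (\<alpha> / (2 * pi) * sqrt (2 * pi * \<nu>) * (1 / (sqrt t * (1 + t))))"
  proof -
    have "sqrt (freq n) = sqrt (2 * pi * \<nu>) * sqrt ?N" by (simp only: freq_def real_sqrt_mult)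
    moreover have "1 / (2 * pi * node n) = \<alpha> / (2 * pi) / ?N" by (simp add: node_def)
    ultimately show ?thesis by (simp only: power2_eq_square) (simp only: divide_inverse inverse_mult_distrib mult_1_left mult_ac)
  qed
  finally have 2: "\<bar>sin (freq n * t) / t * bose_quot (node n) t\<bar> / ?N \<le>
      weight n * (\<alpha> / (2 * pi) * sqrt (2 * pi * \<nu>) * (1 / (sqrt t * (1 + t))))"
    by (simp only: sqrt_divide_square_eq_weight)
  have "\<bar>diff_quot n t\<bar> \<le> \<bar>bose (node n) * ((sin (freq n * t) / t - sin (freq n)) / (1 - t\<^sup>2))\<bar> / ?N +
      \<bar>sin (freq n * t) / t * bose_quot (node n) t\<bar> / ?N"
    unfolding diff_quot_eq[OF assms] abs_divide add_divide_distrib[symmetric]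
    by (simp only: abs_of_nat) (intro divide_right_mono abs_triangle_ineq, simp)
  also have "\<dots> \<le> weight n * majorant t"
    using add_mono[OF 1 2] by (simp only: majorant_def distrib_left[of "weight n"])
  finally show ?thesis .
qed

text \<open>The regularised integrand \<open>F\<close> is absolutely integrable by the majorant, so
  its principal value is its ordinary integral, which is evaluated term by term.\<close>

lemma has_pv_integral_M_integrand:
  obtains I where "has_pv_integral (M_integrand \<alpha> \<nu>) I 1 {0<..}"
    "(\<lambda>n. integral\<^sup>L pos_lborel (diff_quot n)) sums I"
proof -
  define F where "F t = ((\<Sum>n. summand n t) - (\<Sum>n. summand n 1)) / (1 - t\<^sup>2)" for t
  have sums: "(\<lambda>n. diff_quot n t) sums F t" if "t > 0" for t
    unfolding diff_quot_def F_def
    by (intro sums_divide sums_diff summable_sums summable_summand) (use that in auto)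
  have meas: "diff_quot n \<in> borel_measurable pos_lborel" for n
    unfolding diff_quot_def summand_def by (intro borel_measurable_pos_lborel) measurable
  have measF: "F \<in> borel_measurable pos_lborel"
    unfolding F_def summand_def by (intro borel_measurable_pos_lborel) measurable
  have major: "integrable pos_lborel (\<lambda>t. suminf weight * majorant t)"
    unfolding majorant_def
    by (intro integrable_mult_right Bochner_Integration.integrable_add integral_inverse_add_squares
          integrable_inverse_sqrt_mult_add_one) simp
  have AE1: "AE t in pos_lborel. (\<lambda>n. diff_quot n t) sums F t"
    using sums by (intro AE_I2) (auto simp: space_restrict_space)
  have AE2: "AE t in pos_lborel. (\<lambda>n. weight n * majorant t) sums (suminf weight * majorant t)"
    by (intro AE_I2 sums_mult2 summable_sums summable_weight)
  have le: "\<bar>diff_quot n t\<bar> \<le> weight n * majorant t" if "t \<in> space pos_lborel" for n t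
    using that abs_diff_quot_le by (simp add: space_restrict_space)
  have I: "(\<lambda>n. integral\<^sup>L pos_lborel (diff_quot n)) sums integral\<^sup>L pos_lborel F"
    by (rule sums_integral_dominated(2)[OF meas measF le AE1 AE2 major])
  have "integrable pos_lborel F"
  proof (rule Bochner_Integration.integrable_bound[OF major measF])
    show "AE t in pos_lborel. norm (F t) \<le> norm (suminf weight * majorant t)"
    proof (rule AE_I2)
      fix t assume t: "t \<in> space pos_lborel"
      have S: "(\<lambda>n. weight n * majorant t) sums (suminf weight * majorant t)"
        by (intro sums_mult2 summable_sums summable_weight)
      have "norm (F t) \<le> suminf weight * majorant t"
        using norm_sums_le[OF sums S] le[OF t] t by (simp add: space_restrict_space)
      then show "norm (F t) \<le> norm (suminf weight * majorant t)" by simp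
    qed
  qed
  then have "has_pv_integral (\<lambda>t. F t + (\<Sum>n. summand n 1) * (1 / (1 - t\<^sup>2)))
      (integral\<^sup>L pos_lborel F + (\<Sum>n. summand n 1) * 0) 1 {0<..}"
    by (intro has_pv_integral_add has_pv_integral_cmult has_pv_integral_of_integrable
          has_pv_integral_inverse_one_minus_square)
  moreover have "F t + (\<Sum>n. summand n 1) * (1 / (1 - t\<^sup>2)) = M_integrand \<alpha> \<nu> t" for t
    by (simp add: F_def M_integrand_eq diff_divide_distrib)
  ultimately show thesis using that I by simp
qed


section \<open>Laplace terms and the identity for a fixed node\<close>

text \<open>The expansion of \<open>B_fun (\<alpha> * t)\<close> with \<alpha>^2 taken out of the
  denominators. The factor \<open>e\<close> is left free and \<open>t\<close> is real, so that it
  serves both under the integral and at the integers.\<close>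

lemma B_fun_scaled_sums:
  assumes "t > 0"
  shows "(\<lambda>n. e * (1 / ((node n)\<^sup>2 + t\<^sup>2))) sums (pi * \<alpha> * (B_fun (\<alpha> * t) * e / t))"
proof -
  have "(\<lambda>n. \<alpha> * t / ((\<alpha> * t)\<^sup>2 + (real (Suc n))\<^sup>2) / pi * (pi * \<alpha> * (e / t))) sums (B_fun (\<alpha> * t) * (pi * \<alpha> * (e / t)))"
    using \<alpha> assms by (intro sums_mult2 B_fun_sums) simp
  moreover have "\<alpha> * t / ((\<alpha> * t)\<^sup>2 + (real (Suc n))\<^sup>2) / pi * (pi * \<alpha> * (e / t)) = e * (1 / ((node n)\<^sup>2 + t\<^sup>2))" for n
  proof -
    have "(\<alpha> * t)\<^sup>2 + (real (Suc n))\<^sup>2 = \<alpha>\<^sup>2 * ((node n)\<^sup>2 + t\<^sup>2)"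
      using \<alpha> by (simp add: node_def power_divide power_mult_distrib distrib_left)
    then show ?thesis using \<alpha> assms by (simp add: power2_eq_square)
  qed
  ultimately show ?thesis by (simp add: mult_ac)
qed

text \<open>This is \<open>b\<close> of the integrals above; when \<nu> and \<alpha> come from x and
  q it equals - ln x, so the exponential is a power of x.\<close>

definition "rate = 2 * pi * \<nu> * \<alpha>"
definition "laplace n = (LINT t|pos_lborel. exp (- (rate * t)) * (1 / ((node n)\<^sup>2 + t\<^sup>2)))"

lemma rate_pos: "rate > 0"
  using \<alpha> \<nu> by (simp add: rate_def)

lemma integrable_exp_rate: "integrable pos_lborel (\<lambda>t. exp (- (rate * t)))"
  using integrable_I0i_exp_mscale[OF rate_pos] by (simp add: integrable_pos_lborel_iff mult.commute)

lemma integrable_B_fun: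
  "integrable pos_lborel (\<lambda>t. B_fun (\<alpha> * t) * exp (- (rate * t)) / t)"
proof (rule Bochner_Integration.integrable_bound[OF integrable_mult_right[OF integrable_exp_rate, of "\<alpha> * (pi / 6)"]])
  show "(\<lambda>t. B_fun (\<alpha> * t) * exp (- (rate * t)) / t) \<in> borel_measurable pos_lborel"
    unfolding B_fun_def by (intro borel_measurable_pos_lborel) measurable
  show "AE t in pos_lborel. norm (B_fun (\<alpha> * t) * exp (- (rate * t)) / t) \<le> norm (\<alpha> * (pi / 6) * exp (- (rate * t)))"
  proof (rule AE_I2)
    fix t assume "t \<in> space pos_lborel"
    then have t: "t > 0" by (simp add: space_restrict_space)
    then have pos: "\<alpha> * t > 0" using \<alpha> by simp
    have eq: "B_fun (\<alpha> * t) * exp (- (rate * t)) / t = \<alpha> * (B_fun (\<alpha> * t) / (\<alpha> * t)) * exp (- (rate * t))"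
      using \<alpha> by simp
    have "\<alpha> * (B_fun (\<alpha> * t) / (\<alpha> * t)) * exp (- (rate * t)) \<le> \<alpha> * (pi / 6) * exp (- (rate * t))"
      using B_fun_divide_bounds(2)[OF pos] \<alpha> by (intro mult_right_mono mult_left_mono) auto
    moreover have "0 \<le> \<alpha> * (B_fun (\<alpha> * t) / (\<alpha> * t)) * exp (- (rate * t))"
      using B_fun_divide_bounds(1)[OF pos] \<alpha> by (intro mult_nonneg_nonneg) auto
    ultimately show "norm (B_fun (\<alpha> * t) * exp (- (rate * t)) / t) \<le> norm (\<alpha> * (pi / 6) * exp (- (rate * t)))"
      unfolding eq real_norm_def by linarith
  qed
qed

lemma laplace_sums: "laplace sums (pi * \<alpha> * (LINT t|pos_lborel. B_fun (\<alpha> * t) * exp (- (rate * t)) / t))"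
proof -
  let ?f = "\<lambda>n t. exp (- (rate * t)) * (1 / ((node n)\<^sup>2 + t\<^sup>2))"
  have int: "integrable pos_lborel (\<lambda>t. pi * \<alpha> * (B_fun (\<alpha> * t) * exp (- (rate * t)) / t))"
    by (intro integrable_mult_right integrable_B_fun)
  have sums: "AE t in pos_lborel. (\<lambda>n. ?f n t) sums (pi * \<alpha> * (B_fun (\<alpha> * t) * exp (- (rate * t)) / t))"
    by (rule AE_I2, rule B_fun_scaled_sums) (simp add: space_restrict_space)
  have meas: "?f n \<in> borel_measurable pos_lborel" for n
    by (intro borel_measurable_pos_lborel) measurable
  \<comment> \<open>Nonnegative terms: the series is its own majorant.\<close>
  have le: "\<bar>?f n t\<bar> \<le> ?f n t" for n t by simp
  have "(\<lambda>n. integral\<^sup>L pos_lborel (?f n)) sums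
      integral\<^sup>L pos_lborel (\<lambda>t. pi * \<alpha> * (B_fun (\<alpha> * t) * exp (- (rate * t)) / t))"
    by (rule sums_integral_dominated(2)[OF meas borel_measurable_integrable[OF int] le sums sums int])
  then show ?thesis by (simp only: laplace_def[abs_def] integral_mult_right_zero)
qed

text \<open>The exponential sum is written as a sum with numerator 1 minus a sum with numerator 1 -
  exp. The former is an expansion of \<open>B_fun (node n)\<close>, the latter is known from
  \<open>integral_sin_mult_bose_quot\<close>.\<close>

lemma exp_node_sums:
  "(\<lambda>k. exp (- (rate * real (Suc k))) * (1 / ((node n)\<^sup>2 + (real (Suc k))\<^sup>2))) sums
    (laplace n + 2 * \<alpha> * (integral\<^sup>L pos_lborel (diff_quot n) +
      pi / 2 * (cos (freq n) * bose (node n) / real (Suc n)) - \<alpha> / 4 * (1 / (real (Suc n))\<^sup>2)))"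
proof -
  let ?N = "real (Suc n)" and ?a = "node n"
  define J where "J = integral\<^sup>L pos_lborel (diff_quot n)"
  define U where "U = (LINT u|pos_lborel. (1 - exp (- (rate * u))) / (?a\<^sup>2 + u\<^sup>2))"
  define X where "X = (LINT t|pos_lborel. sin (freq n * t) / t * bose_quot ?a t)"
  have a: "?a > 0" by (rule node_pos)
  note I = integral_inverse_add_squares[OF a]
  have "(\<lambda>k. (1 - exp (- (rate * real (Suc k)))) / (?a\<^sup>2 + (real (Suc k))\<^sup>2)) sums (U - 2 / ?a * X)"
    using integral_sin_mult_bose_quot(2)[OF a rate_pos] unfolding U_def X_def freq_eq rate_def .
  moreover have "(\<lambda>k. pi / ?a * (?a / (?a\<^sup>2 + (real (Suc k))\<^sup>2) / pi)) sums (pi / ?a * B_fun ?a)"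
    by (intro sums_mult B_fun_sums a)
  ultimately have "(\<lambda>k. pi / ?a * (?a / (?a\<^sup>2 + (real (Suc k))\<^sup>2) / pi) -
      (1 - exp (- (rate * real (Suc k)))) / (?a\<^sup>2 + (real (Suc k))\<^sup>2)) sums (pi / ?a * B_fun ?a - (U - 2 / ?a * X))"
    by (intro sums_diff)
  moreover have "pi / ?a * (?a / (?a\<^sup>2 + (real (Suc k))\<^sup>2) / pi) - (1 - exp (- (rate * real (Suc k)))) / (?a\<^sup>2 + (real (Suc k))\<^sup>2)
      = exp (- (rate * real (Suc k))) * (1 / (?a\<^sup>2 + (real (Suc k))\<^sup>2))" for k
  proof -
    have "pi / ?a * (?a / (?a\<^sup>2 + (real (Suc k))\<^sup>2) / pi) = 1 / (?a\<^sup>2 + (real (Suc k))\<^sup>2)"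
      using a by simp
    then show ?thesis by (simp add: diff_divide_distrib)
  qed
  moreover have "U = pi / (2 * ?a) - laplace n"
  proof -
    have int: "integrable pos_lborel (\<lambda>t. exp (- (rate * t)) * (1 / (?a\<^sup>2 + t\<^sup>2)))"
    proof (rule Bochner_Integration.integrable_bound[OF I(1)])
      show "(\<lambda>t. exp (- (rate * t)) * (1 / (?a\<^sup>2 + t\<^sup>2))) \<in> borel_measurable pos_lborel"
        by (intro borel_measurable_pos_lborel) measurable
      show "AE t in pos_lborel. norm (exp (- (rate * t)) * (1 / (?a\<^sup>2 + t\<^sup>2))) \<le> norm (1 / (?a\<^sup>2 + t\<^sup>2))"
      proof (rule AE_I2)
        fix t assume "t \<in> space pos_lborel"
        then have "0 \<le> rate * t" using rate_pos by (simp add: space_restrict_space)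
        then have "exp (- (rate * t)) \<le> 1" by simp
        then have "exp (- (rate * t)) * (1 / (?a\<^sup>2 + t\<^sup>2)) \<le> 1 * (1 / (?a\<^sup>2 + t\<^sup>2))"
          by (rule mult_right_mono) simp
        then show "norm (exp (- (rate * t)) * (1 / (?a\<^sup>2 + t\<^sup>2))) \<le> norm (1 / (?a\<^sup>2 + t\<^sup>2))" by simp
      qed
    qed
    have "U = (LINT t|pos_lborel. 1 / (?a\<^sup>2 + t\<^sup>2) - exp (- (rate * t)) * (1 / (?a\<^sup>2 + t\<^sup>2)))"
      unfolding U_def by (simp add: diff_divide_distrib)
    also have "\<dots> = pi / (2 * ?a) - laplace n"
      unfolding laplace_def Bochner_Integration.integral_diff[OF I(1) int] I(2) ..
    finally show ?thesis .
  qed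
  moreover have "X = ?N * J - bose ?a * (pi / 2 * (1 - cos (freq n)))"
    unfolding J_def X_def integral_diff_quot(2) by simp
  \<comment> \<open>The constant 1 / 2 in \<open>B_fun\<close> cancels the arctangent integral, its
    \<open>bose\<close> part cancels the non-cosine part of the remainder, and its pole leaves the
    term in 1 / n^2.\<close>
  moreover have "pi / ?a * B_fun ?a - ((pi / (2 * ?a) - laplace n) - 2 / ?a * (?N * J - bose ?a * (pi / 2 * (1 - cos (freq n))))) =
      laplace n + 2 * \<alpha> * (J + pi / 2 * (cos (freq n) * bose ?a / ?N) - \<alpha> / 4 * (1 / ?N\<^sup>2))"
  proof -
    define p c N where "p = bose ?a" and "c = cos (freq n)" and "N = ?N"
    have N: "N > 0" by (simp add: N_def)
    have a_eq: "?a = N / \<alpha>" by (simp add: node_def N_def)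
    have "pi / ?a * B_fun ?a = pi / ?a * (p - 1 / (2 * pi * ?a) + 1 / 2)"
      by (simp only: B_fun_eq p_def)
    also have "\<dots> = pi * \<alpha> / N * p - \<alpha>\<^sup>2 / (2 * N\<^sup>2) + pi / (2 * ?a)"
      unfolding a_eq using N \<alpha> by (simp add: field_simps power2_eq_square)
    finally have "pi / ?a * B_fun ?a = pi * \<alpha> / N * p - \<alpha>\<^sup>2 / (2 * N\<^sup>2) + pi / (2 * ?a)" .
    moreover have "2 / ?a * (N * J - p * (pi / 2 * (1 - c))) = 2 * \<alpha> * J - pi * \<alpha> / N * p + pi * \<alpha> / N * p * c"
      unfolding a_eq using N \<alpha> by (simp add: field_simps)
    moreover have "2 * \<alpha> * (J + pi / 2 * (c * p / N) - \<alpha> / 4 * (1 / N\<^sup>2)) =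
        2 * \<alpha> * J + pi * \<alpha> / N * p * c - \<alpha>\<^sup>2 / (2 * N\<^sup>2)"
      using N by (simp add: field_simps power2_eq_square)
    ultimately show ?thesis unfolding p_def[symmetric] c_def[symmetric] N_def[symmetric] by linarith
  qed
  ultimately show ?thesis unfolding J_def[symmetric] by (simp only:)
qed

text \<open>One double series over nodes and integers is summed in both orders: nodes first gives
  \<open>Y\<close>, integers first gives the Laplace terms together with the two parts of
  \<open>M_fun\<close>.\<close>

lemma M_fun_value:
  assumes Y: "(\<lambda>k. B_fun (\<alpha> * real (Suc k)) * exp (- (rate * real (Suc k))) / real (Suc k)) sums Y"
  shows "M_fun \<alpha> \<nu> = (LINT t|pos_lborel. B_fun (\<alpha> * t) * exp (- (rate * t)) / t) - Y - pi * \<alpha> / 12"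
proof -
  define Z where "Z = (LINT t|pos_lborel. B_fun (\<alpha> * t) * exp (- (rate * t)) / t)"
  obtain I where pv: "has_pv_integral (M_integrand \<alpha> \<nu>) I 1 {0<..}"
    and I: "(\<lambda>n. integral\<^sup>L pos_lborel (diff_quot n)) sums I"
    by (rule has_pv_integral_M_integrand)
  have zeta: "(\<lambda>n. 1 / (real (Suc n))\<^sup>2) sums (pi\<^sup>2 / 6)"
    using inverse_squares_sums by (simp add: add.commute)
  have "(\<lambda>n. laplace n + 2 * \<alpha> * (integral\<^sup>L pos_lborel (diff_quot n) +
      pi / 2 * (cos (freq n) * bose (node n) / real (Suc n)) - \<alpha> / 4 * (1 / (real (Suc n))\<^sup>2))) sums
      (pi * \<alpha> * Z + 2 * \<alpha> * (I + pi / 2 * cosine_series - \<alpha> / 4 * (pi\<^sup>2 / 6)))"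
    unfolding Z_def
    by (intro sums_add sums_mult sums_diff laplace_sums I cosine_series_sums zeta)
  moreover have "(\<lambda>n. laplace n + 2 * \<alpha> * (integral\<^sup>L pos_lborel (diff_quot n) +
      pi / 2 * (cos (freq n) * bose (node n) / real (Suc n)) - \<alpha> / 4 * (1 / (real (Suc n))\<^sup>2))) sums
      (pi * \<alpha> * Y)"
  proof (rule sums_swap_nonneg[OF _ _ _ exp_node_sums])
    show "(\<lambda>n. exp (- (rate * real (Suc k))) * (1 / ((node n)\<^sup>2 + (real (Suc k))\<^sup>2))) sums
        (pi * \<alpha> * (B_fun (\<alpha> * real (Suc k)) * exp (- (rate * real (Suc k))) / real (Suc k)))" for k
      by (rule B_fun_scaled_sums) simp
    show "(\<lambda>k. pi * \<alpha> * (B_fun (\<alpha> * real (Suc k)) * exp (- (rate * real (Suc k))) / real (Suc k))) sums (pi * \<alpha> * Y)"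
      by (intro sums_mult Y)
  qed simp
  ultimately have "pi * \<alpha> * Z + 2 * \<alpha> * (I + pi / 2 * cosine_series - \<alpha> / 4 * (pi\<^sup>2 / 6)) = pi * \<alpha> * Y"
    by (rule sums_unique2)
  moreover have "pi * \<alpha> * (2 / pi * I) = 2 * \<alpha> * I" by simp
  \<comment> \<open>Division by pi \<alpha> turns 2 \<alpha> (\<alpha> / 4) (pi^2 / 6) into pi
    \<alpha> / 12.\<close>
  ultimately have "(pi * \<alpha>) * (Z + 2 / pi * I + cosine_series - pi * \<alpha> / 12) = (pi * \<alpha>) * Y"
    by (simp add: algebra_simps power2_eq_square)
  then have "Z + 2 / pi * I + cosine_series - pi * \<alpha> / 12 = Y"
    using \<alpha> by simp
  then show ?thesis
    unfolding M_fun_eq pv_integral_eq[OF pv] Z_def[symmetric] by linarith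
qed

end

section \<open>Assembly in terms of q and x\<close>

text \<open>Integrability and existence of the principal value are asserted as well, because the
  Lebesgue integral and the description operator also return values when undefined.\<close>

theorem theorem3:
  fixes q x :: real
  assumes "0 < q" "q < 1" "0 < x" "x < 1"
  shows "set_integrable lborel {0<..} (\<lambda>t. B_fun (- (ln q / (2 * pi)) * t) * x powr t / t) \<and>
    (\<exists>I. has_pv_integral (M_integrand (- (ln q / (2 * pi))) (log q x)) I 1 {0<..}) \<and>
    ln (qpoch_inf x q) =
      dilog x / ln q + ln (sqrt (1 - x)) - ln q / 24
      - (LINT t:{0<..}|lborel. B_fun (- (ln q / (2 * pi)) * t) * x powr t / t)
      + M_fun (- (ln q / (2 * pi))) (log q x)"
proof -
  define \<alpha> \<nu> where "\<alpha> = - (ln q / (2 * pi))" and "\<nu> = log q x"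
  have lnq: "ln q < 0" "ln q = - (2 * pi * \<alpha>)" using assms by (simp_all add: \<alpha>_def)
  have \<alpha>: "\<alpha> > 0" using lnq(1) by (simp add: \<alpha>_def divide_neg_pos)
  have \<nu>: "\<nu> > 0" using lnq(1) assms by (simp add: \<nu>_def log_def divide_neg_neg)
  have q: "q = exp (- (2 * pi * \<alpha>))" using assms lnq(2) by (metis exp_ln)
  have rate: "rate \<alpha> \<nu> = - ln x"
  proof -
    have "rate \<alpha> \<nu> = 2 * pi * (ln x / ln q) * - (ln q / (2 * pi))"
      unfolding rate_def[OF \<alpha> \<nu>] by (simp only: \<alpha>_def \<nu>_def log_def)
    then show ?thesis using lnq(1) by simp
  qed
  have powr: "x powr t = exp (- (rate \<alpha> \<nu> * t))" for t
    using assms by (simp add: rate powr_def mult.commute)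
  have pow: "x ^ Suc k = exp (- (rate \<alpha> \<nu> * real (Suc k)))" for k
    using assms powr_realpow[of x "Suc k"] by (simp only: powr)
  have pv: "\<exists>I. has_pv_integral (M_integrand \<alpha> \<nu>) I 1 {0<..}"
    using has_pv_integral_M_integrand[OF \<alpha> \<nu>] by blast
  have int: "set_integrable lborel {0<..} (\<lambda>t. B_fun (\<alpha> * t) * x powr t / t)"
    using integrable_B_fun[OF \<alpha> \<nu>] by (simp only: powr integrable_pos_lborel_iff)
  have "M_fun \<alpha> \<nu> = (LINT t:{0<..}|lborel. B_fun (\<alpha> * t) * x powr t / t) -
      (dilog x / ln q + ln (1 - x) / 2 - ln (qpoch_inf x q)) - pi * \<alpha> / 12"
    unfolding powr integral_pos_lborel[symmetric]
    by (rule M_fun_value[OF \<alpha> \<nu>, OF ln_qpoch_inf_sums[OF \<alpha> q assms(3,4), unfolded pow]])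
  moreover have "ln (sqrt (1 - x)) = ln (1 - x) / 2"
    using assms by (simp add: ln_sqrt)
  \<comment> \<open>Identifies the leftover from the sum of inverse squares with the term in log
    q.\<close>
  moreover have "ln q / 24 = - (pi * \<alpha> / 12)" using lnq(2) by simp
  ultimately have "ln (qpoch_inf x q) = dilog x / ln q + ln (sqrt (1 - x)) - ln q / 24
      - (LINT t:{0<..}|lborel. B_fun (\<alpha> * t) * x powr t / t) + M_fun \<alpha> \<nu>"
    by linarith
  with pv int show ?thesis unfolding \<alpha>_def \<nu>_def by blast
qed

end
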